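(* Let $1\le p<\infty$, and let $i:X\to Y$ be an isometric embedding of Banach spaces. Suppose there exists $c>0$ such that, for every $s\in\mathbb N$, there exists a subspace $F_s\subset X^*$ which is $c$-isomorphic to $\ell_2^s$ and $c$-complemented in $X^*$ via a weak$^*$-continuous projection $Q_s$ (that is, $Q_s:X^*\to X^*$ is a weak$^*$-continuous projection with range $F_s$ and $\|Q_s\|\le c$). Suppose, furthermore, that $\lim_{s\to\infty}s^{-1/2}\pi_p(Q_si^* )=0$. Then $\overline{i}(\mathrm{FBL}^{(p)}[X])$ is not a regular sublattice of $\mathrm{FBL}^{(p)}[Y]$.
   Context: All Banach spaces are real; embeddings are linear. $\pi_p$ denotes the $p$-summing norm. Two spaces are $c$-isomorphic if there is an isomorphism $u$ between them with $\|u\|\|u^{-1}\|\le c$. Let $1/p+1/p'=1$. For $z_1,\dots,z_n$ in a Banach space, $\|(z_i)_{i=1}^n\|_{p,\mathrm{weak}}=\sup\{\|\sum_i\alpha_i z_i\| : \|(\alpha_i)_i\|_{\ell_{p'}}\le 1\}$. For a Banach space $X$, $H_{w^*}[X]$ is the vector lattice (pointwise operations and order) of positively homogeneous functions $f:X^*\to\mathbb R$ that are weak$^*$-continuous on bounded sets. For $f\in H_{w^*}[X]$, $\|f\|_p$ is the infimum of all $C\ge 0$ such that $(\sum_{i=1}^n|f(x_i^* )|^p)^{1/p}\le C\|(x_i^* )_{i=1}^n\|_{p,\mathrm{weak}}$ for all $n$ and all $x_1^*,\dots,x_n^*\in X^*$. $H_{w^*}^p[X]=\{f\in H_{w^*}[X]:\|f\|_p<\infty\}$,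 normed by $\|\cdot\|_p$. For $x\in X$, $\delta_x(x^* )=\langle x^*,x\rangle$. $\mathrm{FVL}[X]$ is the vector sublattice of $H_{w^*}[X]$ generated by $\{\delta_x:x\in X\}$; $\mathrm{FBL}^{(p)}[X]$ is the closure of $\mathrm{FVL}[X]$ in $H_{w^*}^p[X]$. For a bounded operator $i:X\to Y$, $\overline{i}:H_{w^*}^p[X]\to H_{w^*}^p[Y]$ is the lattice homomorphism $[\overline{i}f](y^* )=f(i^*y^* )$; it maps $\mathrm{FBL}^{(p)}[X]$ into $\mathrm{FBL}^{(p)}[Y]$, and is injective when $i$ is. For an injective lattice homomorphism $j:E\to F$ of vector lattices, $j(E)$ is a regular sublattice of $F$ if for every set $A\subset E$ having a supremum $a$ in $E$, $ja$ is the supremum of $j(A)$ in $F$. *)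

theory Defs
  imports "HOL-Analysis.Analysis" "HOL-Library.Lub_Glb"
begin

text \<open>The dual of \<open>'a\<close> is the type \<open>'a \<Rightarrow>\<^sub>L real\<close>. For scalar-valued operators the strong operator
  topology is the topology of pointwise convergence, which is the weak-star topology.\<close>

abbreviation weak_star :: "('a::real_normed_vector \<Rightarrow>\<^sub>L real) topology"
  where "weak_star \<equiv> strong_operator_topology"

definition adj :: "('a::real_normed_vector \<Rightarrow>\<^sub>L 'b::real_normed_vector)
    \<Rightarrow> ('b \<Rightarrow>\<^sub>L real) \<Rightarrow> ('a \<Rightarrow>\<^sub>L real)"
  where "adj i y = y o\<^sub>L i"


section \<open>Finite-dimensional sequence spaces, weak and summing norms\<close>

text \<open>A tuple of length \<open>n\<close> is a function on \<open>nat\<close> of which only the values at \<open>0, \<dots>, n - 1\<close> are used.\<close>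

definition ell_norm :: "ereal \<Rightarrow> nat \<Rightarrow> (nat \<Rightarrow> real) \<Rightarrow> real"
  where "ell_norm q n a =
    (if q = \<infinity> then Max (insert 0 ((\<lambda>k. \<bar>a k\<bar>) ` {..<n}))
     else (\<Sum>k<n. \<bar>a k\<bar> powr real_of_ereal q) powr (1 / real_of_ereal q))"

definition conj_exp :: "real \<Rightarrow> ereal"
  where "conj_exp p = (if p = 1 then \<infinity> else ereal (p / (p - 1)))"

definition weak_norm :: "real \<Rightarrow> nat \<Rightarrow> (nat \<Rightarrow> 'z::real_normed_vector) \<Rightarrow> real"
  where "weak_norm p n z =
    (SUP a\<in>{a. ell_norm (conj_exp p) n a \<le> 1}. norm (\<Sum>k<n. a k *\<^sub>R z k))"

text \<open>The value is \<open>\<infinity>\<close> if \<open>T\<close> is not \<open>p\<close>-summing.\<close>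

definition summing_norm ::
    "real \<Rightarrow> ('z::real_normed_vector \<Rightarrow> 'w::real_normed_vector) \<Rightarrow> ennreal"
  where "summing_norm p T =
    (INF C\<in>{C. 0 \<le> C \<and> (\<forall>n z. (\<Sum>k<n. norm (T (z k)) powr p) powr (1 / p) \<le> C * weak_norm p n z)}.
      ennreal C)"

text \<open>The space \<open>\<ell>\<^sub>2\<^sup>s\<close> consists of the sequences supported on \<open>{..<s}\<close>.
  The constants \<open>K\<close> and \<open>L\<close> bound the operator norms of \<open>u\<close> and of its inverse.\<close>

definition ell_carrier :: "nat \<Rightarrow> (nat \<Rightarrow> real) set"
  where "ell_carrier s = {a. \<forall>k\<ge>s. a k = 0}"

definition isomorphic_ell2 :: "real \<Rightarrow> nat \<Rightarrow> 'z::real_normed_vector set \<Rightarrow> bool"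
  where "isomorphic_ell2 c s F \<longleftrightarrow>
    (\<exists>u K L. bij_betw u (ell_carrier s) F
      \<and> (\<forall>a\<in>ell_carrier s. \<forall>b\<in>ell_carrier s. u (\<lambda>k. a k + b k) = u a + u b)
      \<and> (\<forall>r. \<forall>a\<in>ell_carrier s. u (\<lambda>k. r * a k) = r *\<^sub>R u a)
      \<and> 0 \<le> K \<and> (\<forall>a\<in>ell_carrier s. norm (u a) \<le> K * ell_norm 2 s a)
      \<and> 0 \<le> L \<and> (\<forall>a\<in>ell_carrier s. ell_norm 2 s a \<le> L * norm (u a))
      \<and> K * L \<le> c)"


section \<open>Free Banach lattices\<close>

definition Hw :: "(('a::real_normed_vector \<Rightarrow>\<^sub>L real) \<Rightarrow> real) set"
  where "Hw = {f. (\<forall>r\<ge>0. \<forall>\<xi>. f (r *\<^sub>R \<xi>) = r * f \<xi>)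
    \<and> (\<forall>B. bounded B \<longrightarrow> continuous_map (subtopology weak_star B) euclideanreal f)}"

definition fbl_norm :: "real \<Rightarrow> (('a::real_normed_vector \<Rightarrow>\<^sub>L real) \<Rightarrow> real) \<Rightarrow> ennreal"
  where "fbl_norm p f =
    (INF C\<in>{C. 0 \<le> C \<and> (\<forall>n \<xi>. (\<Sum>k<n. \<bar>f (\<xi> k)\<bar> powr p) powr (1 / p) \<le> C * weak_norm p n \<xi>)}.
      ennreal C)"

definition Hwp :: "real \<Rightarrow> (('a::real_normed_vector \<Rightarrow>\<^sub>L real) \<Rightarrow> real) set"
  where "Hwp p = {f \<in> Hw. fbl_norm p f < \<infinity>}"

definition delta :: "'a::real_normed_vector \<Rightarrow> ('a \<Rightarrow>\<^sub>L real) \<Rightarrow> real"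
  where "delta x \<xi> = blinfun_apply \<xi> x"

definition vector_sublattice :: "('d \<Rightarrow> real) set \<Rightarrow> bool"
  where "vector_sublattice L \<longleftrightarrow>
    (\<lambda>_. 0) \<in> L
    \<and> (\<forall>f\<in>L. \<forall>g\<in>L. (\<lambda>\<xi>. f \<xi> + g \<xi>) \<in> L)
    \<and> (\<forall>r. \<forall>f\<in>L. (\<lambda>\<xi>. r * f \<xi>) \<in> L)
    \<and> (\<forall>f\<in>L. \<forall>g\<in>L. sup f g \<in> L \<and> inf f g \<in> L)"

definition FVL :: "(('a::real_normed_vector \<Rightarrow>\<^sub>L real) \<Rightarrow> real) set"
  where "FVL = (\<lambda>L. L \<subseteq> Hw \<and> vector_sublattice L) hull range delta"

definition FBL :: "real \<Rightarrow> (('a::real_normed_vector \<Rightarrow>\<^sub>L real) \<Rightarrow> real) set"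
  where "FBL p = {f \<in> Hwp p. \<forall>e>0. \<exists>g\<in>FVL. fbl_norm p (\<lambda>\<xi>. f \<xi> - g \<xi>) < e}"

definition bar :: "('a::real_normed_vector \<Rightarrow>\<^sub>L 'b::real_normed_vector)
    \<Rightarrow> (('a \<Rightarrow>\<^sub>L real) \<Rightarrow> real) \<Rightarrow> (('b \<Rightarrow>\<^sub>L real) \<Rightarrow> real)"
  where "bar i f = (\<lambda>y. f (adj i y))"

text \<open>Here \<open>E\<close> and \<open>F\<close> carry the order of the ambient type and \<open>j\<close> is understood to restrict to an
  injective lattice homomorphism from \<open>E\<close> into \<open>F\<close>. \<open>isLub E A a\<close> says that \<open>a\<close> is the supremum of \<open>A\<close>
  computed in \<open>E\<close>.\<close>

definition regular_image :: "('d::ord \<Rightarrow> 'e::ord) \<Rightarrow> 'd set \<Rightarrow> 'e set \<Rightarrow> bool"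
  where "regular_image j E F \<longleftrightarrow>
    (\<forall>A a. A \<subseteq> E \<and> isLub E A a \<longrightarrow> isLub F (j ` A) (j a))"

end

theory Submission
  imports Defs
begin

text \<open>
  In coordinates \<open>v\<^sub>1, \<dots>, v\<^sub>s\<close> of \<open>Q\<^sub>s\<close>, put \<open>h\<^sub>s = s\<^sup>-\<^sup>1 (\<bar>\<delta>\<^bsub>v\<^sub>1\<^esub>\<bar> + \<dots> + \<bar>\<delta>\<^bsub>v\<^sub>s\<^esub>\<bar>)\<close>.
  This is an element of the free vector lattice over \<open>X\<close> and is dominated by \<open>s\<^sup>-\<^sup>1\<^sup>/\<^sup>2 \<parallel>Q\<^sub>s \<xi>\<parallel>\<close>, so the
  norms of the images of the \<open>h\<^sub>s\<close> over \<open>Y\<close> tend to \<open>0\<close>. Along a sparse subsequence the series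
  \<open>G = \<Sum> 2\<^sup>k h\<^sub>k\<close> therefore converges over \<open>Y\<close>, and the functions \<open>(\<bar>\<delta>\<^sub>x\<bar> - \<Sum>\<^sub>k\<^sub><\<^sub>n 2\<^sup>k h\<^sub>k)\<^sup>+\<close> keep a
  nonzero lower bound over \<open>Y\<close>, namely \<open>(\<bar>\<delta>\<^sub>x\<bar> - G)\<^sup>+\<close>. Over \<open>X\<close> their infimum is \<open>0\<close>: at the
  \<open>2\<^sup>s\<close> vectors of \<open>F\<^sub>s\<close> with coordinates \<open>\<plusminus>1\<close> the function \<open>h\<^sub>s\<close> is at least \<open>1\<close>, whereas by
  Khintchine's inequality the weak \<open>p\<close>-norm of these vectors is of order \<open>(2\<^sup>s)\<^sup>1\<^sup>/\<^sup>p\<close>, so an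
  element of the free Banach lattice hardly notices, on average, a translation by a small multiple
  of one of them.
\<close>

section \<open>Weak norms and summing bounds\<close>

lemma ell_norm_zero: "ell_norm q n (\<lambda>_. 0) = 0"
  by (cases "n = 0") (auto simp: ell_norm_def image_constant_conv)

text \<open>Hoelder's inequality, weakened: for the mean \<open>x\<close> of the \<open>p\<close>-th
  powers, \<open>x powr (1 / p)\<close> is replaced by \<open>1 + x\<close>, so that the bound is
  affine in a sum that Khintchine's inequality controls. For \<open>p > 1\<close> it comes from
  Young's inequality.\<close>

lemma sum_conj_le:
  assumes p: "1 \<le> p" and a: "ell_norm (conj_exp p) n a \<le> 1" and n: "0 < n"
    and t: "\<And>k. 0 \<le> t k"
  shows "(\<Sum>k<n. \<bar>a k\<bar> * t k) \<le> real n powr (1 / p) * (1 + (\<Sum>k<n. t k powr p) / real n)"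
proof (cases "p = 1")
  case True
  have "\<bar>a k\<bar> \<le> 1" if "k < n" for k
    using a that True by (auto simp: ell_norm_def conj_exp_def)
  then have "(\<Sum>k<n. \<bar>a k\<bar> * t k) \<le> (\<Sum>k<n. t k)"
    by (intro sum_mono) (auto simp: t intro!: mult_left_le_one_le)
  also have "\<dots> \<le> n + (\<Sum>k<n. t k)" by simp
  also have "\<dots> = n powr (1 / p) * (1 + (\<Sum>k<n. t k powr p) / n)"
    using True n t by (simp add: distrib_left)
  finally show ?thesis .
next
  case False
  then have p1: "1 < p" using p by simp
  define q where "q = p / (p - 1)"
  have q: "1 < q" "1 / q + 1 / p = 1" using p1 by (auto simp: q_def field_simps)
  have "(\<Sum>k<n. \<bar>a k\<bar> powr q) powr (1 / q) \<le> 1"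
    using a p1 by (simp add: ell_norm_def conj_exp_def q_def)
  then have "((\<Sum>k<n. \<bar>a k\<bar> powr q) powr (1 / q)) powr q \<le> 1 powr q"
    using q by (intro powr_mono2) auto
  then have sa: "(\<Sum>k<n. \<bar>a k\<bar> powr q) \<le> 1"
    using q by (simp add: powr_powr sum_nonneg)
  \<comment> \<open>Scaling \<open>a\<close> by \<open>B\<close> raises the bound on its
    \<open>q\<close>-th power sum from \<open>1\<close> to \<open>n\<close>, and
    \<open>n powr (1 / p)\<close> equals \<open>n / B\<close>, so dividing the summed Young
    inequality by \<open>B\<close> produces the claimed factor.\<close>
  define B where "B = real n powr (1 / q)"
  have B: "B > 0" "B powr q = n" using n q by (auto simp: B_def powr_powr)
  have nB: "real n powr (1 / p) * B = n"
    using n q unfolding B_def by (simp flip: powr_add add: add.commute)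
  have "(\<bar>a k\<bar> * B) * t k \<le> n * \<bar>a k\<bar> powr q + t k powr p" for k
  proof -
    have "(\<bar>a k\<bar> * B) * t k \<le> (\<bar>a k\<bar> * B) powr q / q + t k powr p / p"
      using q p1 B t by (intro Youngs_inequality) auto
    also have "\<dots> \<le> (\<bar>a k\<bar> * B) powr q + t k powr p"
      using q p1 by (intro add_mono) (auto simp: divide_le_eq mult_le_cancel_left1)
    finally show ?thesis using B by (simp add: powr_mult mult.commute)
  qed
  then have "(\<Sum>k<n. (\<bar>a k\<bar> * B) * t k) \<le> (\<Sum>k<n. n * \<bar>a k\<bar> powr q + t k powr p)"
    by (rule sum_mono)
  also have "\<dots> = n * (\<Sum>k<n. \<bar>a k\<bar> powr q) + (\<Sum>k<n. t k powr p)"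
    by (simp add: sum.distrib sum_distrib_left)
  also have "\<dots> \<le> n + (\<Sum>k<n. t k powr p)"
    using sa by (simp add: mult_left_le)
  finally have "B * (\<Sum>k<n. \<bar>a k\<bar> * t k) \<le> n + (\<Sum>k<n. t k powr p)"
    by (simp add: sum_distrib_left mult_ac)
  also have "\<dots> = B * (real n powr (1 / p) * (1 + (\<Sum>k<n. t k powr p) / real n))"
    unfolding mult.assoc[symmetric] mult.commute[of B] nB using n by (simp add: distrib_left)
  finally show ?thesis using B by simp
qed

text \<open>A real supremum is sure to dominate its set only when the set is bounded.\<close>

lemma weak_norm_bdd:
  assumes p: "1 \<le> p"
  shows "bdd_above ((\<lambda>a. norm (\<Sum>k<n. a k *\<^sub>R z k)) ` {a. ell_norm (conj_exp p) n a \<le> 1})"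
proof (cases "n = 0")
  case False
  have "norm (\<Sum>k<n. a k *\<^sub>R z k) \<le> real n powr (1 / p) * (1 + (\<Sum>k<n. norm (z k) powr p) / real n)"
    if "ell_norm (conj_exp p) n a \<le> 1" for a
  proof -
    have "norm (\<Sum>k<n. a k *\<^sub>R z k) \<le> (\<Sum>k<n. \<bar>a k\<bar> * norm (z k))"
      by (metis (no_types, lifting) norm_scaleR norm_sum sum.cong)
    also have "\<dots> \<le> real n powr (1 / p) * (1 + (\<Sum>k<n. norm (z k) powr p) / real n)"
      using False that by (intro sum_conj_le p) auto
    finally show ?thesis .
  qed
  then show ?thesis by (intro bdd_aboveI2) auto
qed auto

lemma weak_norm_upper:
  assumes "1 \<le> p" "ell_norm (conj_exp p) n a \<le> 1"
  shows "norm (\<Sum>k<n. a k *\<^sub>R z k) \<le> weak_norm p n z"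
  unfolding weak_norm_def using weak_norm_bdd[OF assms(1)] assms(2)
  by (intro cSUP_upper) auto

lemma weak_norm_nonneg: "1 \<le> p \<Longrightarrow> 0 \<le> weak_norm p n z"
  using weak_norm_upper[of p n "\<lambda>_. 0" z] by (simp add: ell_norm_zero)

lemma weak_norm_le:
  assumes "\<And>a. ell_norm (conj_exp p) n a \<le> 1 \<Longrightarrow> norm (\<Sum>k<n. a k *\<^sub>R z k) \<le> B"
  shows "weak_norm p n z \<le> B"
proof -
  have "(\<lambda>_. 0) \<in> {a. ell_norm (conj_exp p) n a \<le> 1}" by (simp add: ell_norm_zero)
  then show ?thesis unfolding weak_norm_def using assms by (intro cSUP_least) auto
qed

text \<open>By \<open>sum_conj_le\<close> with \<open>t = 1\<close>, the coefficients have absolute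
  sum at most \<open>2 * n powr (1 / p)\<close>; hence the factor 2. A fixed centre thus costs only
  the order \<open>n powr (1 / p)\<close>, like the sign tuples used later.\<close>

lemma weak_norm_translate:
  assumes p: "1 \<le> p" and n: "0 < n"
  shows "weak_norm p n (\<lambda>k. \<xi> + \<theta> *\<^sub>R z k)
    \<le> 2 * real n powr (1 / p) * norm \<xi> + \<bar>\<theta>\<bar> * weak_norm p n z"
proof (rule weak_norm_le)
  fix a assume a: "ell_norm (conj_exp p) n a \<le> 1"
  have s: "(\<Sum>k<n. \<bar>a k\<bar>) \<le> 2 * real n powr (1 / p)"
    using sum_conj_le[OF p a n, of "\<lambda>_. 1"] n by simp
  have "(\<Sum>k<n. a k *\<^sub>R (\<xi> + \<theta> *\<^sub>R z k)) = (\<Sum>k<n. a k) *\<^sub>R \<xi> + \<theta> *\<^sub>R (\<Sum>k<n. a k *\<^sub>R z k)"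
    by (simp add: scaleR_add_right sum.distrib scaleR_sum_left scaleR_sum_right mult.commute)
  also have "norm \<dots> \<le> \<bar>\<Sum>k<n. a k\<bar> * norm \<xi> + \<bar>\<theta>\<bar> * norm (\<Sum>k<n. a k *\<^sub>R z k)"
    by (metis norm_scaleR norm_triangle_ineq)
  also have "\<dots> \<le> 2 * real n powr (1 / p) * norm \<xi> + \<bar>\<theta>\<bar> * weak_norm p n z"
    using order_trans[OF sum_abs s]
    by (intro add_mono mult_right_mono mult_left_mono weak_norm_upper p a) auto
  finally show "norm (\<Sum>k<n. a k *\<^sub>R (\<xi> + \<theta> *\<^sub>R z k))
    \<le> 2 * real n powr (1 / p) * norm \<xi> + \<bar>\<theta>\<bar> * weak_norm p n z" .
qed

text \<open>A real admissible constant, not the least one, stands in for the extended-real infimum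
  of \<open>summing_norm\<close>. The root is removed so that power sums can be added, and
  positivity allows division by \<open>C\<close>.\<close>

definition summing_bound :: "real \<Rightarrow> real \<Rightarrow> ('z::real_normed_vector \<Rightarrow> real) \<Rightarrow> bool"
  where "summing_bound p C f \<longleftrightarrow>
    0 < C \<and> (\<forall>n z. (\<Sum>k<n. \<bar>f (z k)\<bar> powr p) \<le> (C * weak_norm p n z) powr p)"

lemma powr_le_iff_le_powr:
  fixes S W p :: real
  assumes "0 < p" "0 \<le> S" "0 \<le> W"
  shows "S powr (1 / p) \<le> W \<longleftrightarrow> S \<le> W powr p"
proof
  assume "S powr (1 / p) \<le> W"
  then have "(S powr (1 / p)) powr p \<le> W powr p"
    using assms by (intro powr_mono2) auto
  then show "S \<le> W powr p" using assms by (simp add: powr_powr)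
next
  assume "S \<le> W powr p"
  then have "S powr (1 / p) \<le> (W powr p) powr (1 / p)"
    using assms by (intro powr_mono2) auto
  then show "S powr (1 / p) \<le> W" using assms by (simp add: powr_powr)
qed

lemma summing_bound_iff:
  assumes "1 \<le> p" "0 < C"
  shows "summing_bound p C f \<longleftrightarrow>
    (\<forall>n z. (\<Sum>k<n. \<bar>f (z k)\<bar> powr p) powr (1 / p) \<le> C * weak_norm p n z)"
  unfolding summing_bound_def using assms
  by (subst powr_le_iff_le_powr) (auto simp: weak_norm_nonneg sum_nonneg)

lemma summing_bound_mono:
  assumes "summing_bound p C g" "\<And>z. \<bar>f z\<bar> \<le> \<bar>g z\<bar>" "C \<le> D" "1 \<le> p"
  shows "summing_bound p D f"
  unfolding summing_bound_def
proof (intro conjI allI)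
  show "0 < D" using assms by (auto simp: summing_bound_def)
  fix n and z :: "nat \<Rightarrow> 'a"
  have "(\<Sum>k<n. \<bar>f (z k)\<bar> powr p) \<le> (\<Sum>k<n. \<bar>g (z k)\<bar> powr p)"
    using assms by (intro sum_mono powr_mono2) auto
  also have "\<dots> \<le> (C * weak_norm p n z) powr p"
    using assms by (auto simp: summing_bound_def)
  also have "\<dots> \<le> (D * weak_norm p n z) powr p"
    using assms by (intro powr_mono2 mult_right_mono) (auto simp: weak_norm_nonneg summing_bound_def)
  finally show "(\<Sum>k<n. \<bar>f (z k)\<bar> powr p) \<le> (D * weak_norm p n z) powr p" .
qed

lemma powr_convex_combination:
  fixes x y C D p :: real
  assumes p: "1 \<le> p" and "0 < C" "0 < D" and nn: "0 \<le> x" "0 \<le> y"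
  shows "((C * x + D * y) / (C + D)) powr p \<le> (C * x powr p + D * y powr p) / (C + D)"
proof -
  have less: "(v * r) powr p \<le> v * r powr p" if "0 \<le> v" "v \<le> 1" "0 \<le> r" for v r :: real
  proof -
    have "v powr p \<le> v" using powr_mono'[of 1 p v] that p by simp
    then have "v powr p * r powr p \<le> v * r powr p" by (rule mult_right_mono) simp
    then show ?thesis by (simp add: powr_mult that)
  qed
  \<comment> \<open>Convexity is invoked only for positive arguments; if one of them is zero,
    \<open>v powr p \<le> v\<close> on the unit interval suffices.\<close>
  consider "x = 0" | "y = 0" | "0 < x" "0 < y" using nn by linarith
  then show ?thesis
  proof cases
    case 1
    then show ?thesis using less[of "D / (C + D)" y] assms by simp
  next
    case 2
    then show ?thesis using less[of "C / (C + D)" x] assms by simp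
  next
    case 3
    have "(C / (C + D)) + (D / (C + D)) = 1" using assms by (simp flip: add_divide_distrib)
    moreover have "0 \<le> C / (C + D)" "0 \<le> D / (C + D)" using assms by simp_all
    ultimately have "((C / (C + D)) *\<^sub>R x + (D / (C + D)) *\<^sub>R y) powr p
        \<le> (C / (C + D)) * x powr p + (D / (C + D)) * y powr p"
      using powr_convex[OF p] 3 unfolding convex_on_def by blast
    then show ?thesis by (simp add: add_divide_distrib)
  qed
qed

text \<open>Minkowski's inequality: \<open>\<bar>f + g\<bar> / (C + D)\<close> is at most the convex
  combination of \<open>\<bar>f\<bar> / C\<close> and \<open>\<bar>g\<bar> / D\<close> with weights
  proportional to \<open>C\<close> and \<open>D\<close>, so convexity of the \<open>p\<close>-th
  power applies termwise.\<close>

lemma summing_bound_add: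
  assumes f: "summing_bound p C f" and g: "summing_bound p D g" and p: "1 \<le> p"
  shows "summing_bound p (C + D) (\<lambda>z. f z + g z)"
  unfolding summing_bound_def
proof (intro conjI allI)
  have C: "0 < C" and D: "0 < D" using f g by (auto simp: summing_bound_def)
  then show "0 < C + D" by simp
  fix n and z :: "nat \<Rightarrow> 'a"
  let ?W = "weak_norm p n z"
  let ?E = "(C + D) powr p"
  have W: "0 \<le> ?W" using p by (rule weak_norm_nonneg)
  have pt: "\<bar>f x + g x\<bar> powr p
    \<le> ?E * ((C * (\<bar>f x\<bar> powr p / C powr p) + D * (\<bar>g x\<bar> powr p / D powr p)) / (C + D))" for x
  proof -
    have "\<bar>f x + g x\<bar> powr p
        \<le> ((C + D) * ((C * (\<bar>f x\<bar> / C) + D * (\<bar>g x\<bar> / D)) / (C + D))) powr p"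
      using C D p by (intro powr_mono2) auto
    also have "\<dots> = ?E * ((C * (\<bar>f x\<bar> / C) + D * (\<bar>g x\<bar> / D)) / (C + D)) powr p"
      by (rule powr_mult)
    also have "\<dots> \<le> ?E * ((C * (\<bar>f x\<bar> / C) powr p + D * (\<bar>g x\<bar> / D) powr p) / (C + D))"
      using C D p by (intro mult_left_mono powr_convex_combination) auto
    finally show ?thesis using C D by (simp add: powr_divide)
  qed
  have sf: "(\<Sum>k<n. \<bar>f (z k)\<bar> powr p) / C powr p \<le> ?W powr p"
    using f C by (auto simp: summing_bound_def powr_mult divide_le_eq mult.commute)
  have sg: "(\<Sum>k<n. \<bar>g (z k)\<bar> powr p) / D powr p \<le> ?W powr p"
    using g D by (auto simp: summing_bound_def powr_mult divide_le_eq mult.commute)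
  have "(\<Sum>k<n. \<bar>f (z k) + g (z k)\<bar> powr p)
    \<le> (\<Sum>k<n. ?E * ((C * (\<bar>f (z k)\<bar> powr p / C powr p) + D * (\<bar>g (z k)\<bar> powr p / D powr p)) / (C + D)))"
    by (intro sum_mono pt)
  also have "\<dots> = ?E * ((C * ((\<Sum>k<n. \<bar>f (z k)\<bar> powr p) / C powr p)
      + D * ((\<Sum>k<n. \<bar>g (z k)\<bar> powr p) / D powr p)) / (C + D))"
    by (simp only: sum_distrib_left[symmetric] sum_divide_distrib[symmetric] sum.distrib)
  also have "\<dots> \<le> ?E * ((C * ?W powr p + D * ?W powr p) / (C + D))"
    using C D by (intro mult_left_mono divide_right_mono add_mono sf sg) auto
  also have "\<dots> = ((C + D) * ?W) powr p"
    using C D by (simp add: powr_mult flip: distrib_right)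
  finally show "(\<Sum>k<n. \<bar>f (z k) + g (z k)\<bar> powr p) \<le> ((C + D) * ?W) powr p" .
qed

lemma summing_bound_scale:
  assumes f: "summing_bound p C f" and "0 < D" "\<bar>r\<bar> * C \<le> D" "1 \<le> p"
  shows "summing_bound p D (\<lambda>z. r * f z)"
  unfolding summing_bound_def
proof (intro conjI allI assms(2))
  fix n and z :: "nat \<Rightarrow> 'a"
  have "(\<Sum>k<n. \<bar>r * f (z k)\<bar> powr p) = \<bar>r\<bar> powr p * (\<Sum>k<n. \<bar>f (z k)\<bar> powr p)"
    by (simp add: abs_mult powr_mult sum_distrib_left)
  also have "\<dots> \<le> \<bar>r\<bar> powr p * (C * weak_norm p n z) powr p"
    using f by (intro mult_left_mono) (auto simp: summing_bound_def)
  also have "\<dots> = (\<bar>r\<bar> * C * weak_norm p n z) powr p"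
    by (simp add: powr_mult mult_ac)
  also have "\<dots> \<le> (D * weak_norm p n z) powr p"
    using assms by (intro powr_mono2 mult_right_mono) (auto simp: weak_norm_nonneg summing_bound_def)
  finally show "(\<Sum>k<n. \<bar>r * f (z k)\<bar> powr p) \<le> (D * weak_norm p n z) powr p" .
qed

text \<open>Each inequality tests finitely many points, so pointwise convergence is enough.\<close>

lemma summing_bound_limit:
  assumes f: "\<And>m. summing_bound p C (f m)" and lim: "\<And>z. (\<lambda>m. f m z) \<longlonglongrightarrow> g z" and p: "1 \<le> p"
  shows "summing_bound p C g"
  unfolding summing_bound_def
proof (intro conjI allI)
  show "0 < C" using f by (auto simp: summing_bound_def)
  fix n and z :: "nat \<Rightarrow> 'a"
  have "(\<lambda>m. \<Sum>k<n. \<bar>f m (z k)\<bar> powr p) \<longlonglongrightarrow> (\<Sum>k<n. \<bar>g (z k)\<bar> powr p)"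
    using p by (intro tendsto_sum tendsto_powr' tendsto_rabs lim tendsto_const) auto
  then show "(\<Sum>k<n. \<bar>g (z k)\<bar> powr p) \<le> (C * weak_norm p n z) powr p"
    using f by (intro LIMSEQ_le_const2) (auto simp: summing_bound_def)
qed

text \<open>Summing up to \<open>Suc m\<close> avoids the empty sum, whose constant 0 is not allowed
  in \<open>summing_bound\<close>.\<close>

lemma summing_bound_sum:
  assumes "\<And>k. summing_bound p (C k) (f k)" "1 \<le> p"
  shows "summing_bound p (\<Sum>k<Suc m. C k) (\<lambda>z. \<Sum>k<Suc m. f k z)"
proof (induction m)
  case 0
  then show ?case using assms by simp
next
  case (Suc m)
  then show ?case
    using summing_bound_add[OF Suc assms(1)[of "Suc m"] assms(2)] by simp
qed

text \<open>Tuples of length one; \<open>weak_norm_translate\<close> with scalar 0 estimates their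
  weak norm, whence the factor 2.\<close>

lemma summing_bound_pointwise:
  assumes f: "summing_bound p C f" and p: "1 \<le> p"
  shows "\<bar>f z\<bar> \<le> 2 * C * norm z"
proof -
  have C: "0 < C" using f by (auto simp: summing_bound_def)
  have "weak_norm p 1 (\<lambda>_. z + 0 *\<^sub>R z) \<le> 2 * real 1 powr (1 / p) * norm z + \<bar>0\<bar> * weak_norm p 1 (\<lambda>_. z)"
    by (rule weak_norm_translate[OF p]) simp
  then have W: "weak_norm p 1 (\<lambda>_. z) \<le> 2 * norm z" by simp
  have "(\<Sum>k<(1::nat). \<bar>f z\<bar> powr p) powr (1 / p) \<le> C * weak_norm p 1 (\<lambda>_. z)"
    using f[unfolded summing_bound_iff[OF p C], rule_format, of "\<lambda>_. z" 1] by simp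
  then have "\<bar>f z\<bar> \<le> C * weak_norm p 1 (\<lambda>_. z)" using p by (simp add: powr_powr)
  also have "\<dots> \<le> C * (2 * norm z)" using C W by (intro mult_left_mono) auto
  finally show ?thesis by simp
qed

text \<open>Duality of sequence spaces: the root of the power sum is attained by pairing with a
  vector of the dual unit ball, and this pairing is the value at \<open>x\<close> of one of the sums
  in \<open>weak_norm\<close>. The summand 1 keeps the constant positive for
  \<open>x = 0\<close>.\<close>

lemma summing_bound_delta:
  assumes p: "1 \<le> p"
  shows "summing_bound p (norm x + 1) (delta x)"
  unfolding summing_bound_iff[OF p add_nonneg_pos[OF norm_ge_zero zero_less_one]]
proof (intro allI)
  fix n and z :: "nat \<Rightarrow> 'a \<Rightarrow>\<^sub>L real"
  define t where "t k = blinfun_apply (z k) x" for k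
  define S where "S = (\<Sum>k<n. \<bar>t k\<bar> powr p)"
  have S0: "0 \<le> S" by (simp add: S_def sum_nonneg)
  have "\<exists>a. ell_norm (conj_exp p) n a \<le> 1 \<and> S powr (1 / p) = (\<Sum>k<n. a k * t k)"
  proof (cases "p = 1")
    case True
    have "ell_norm (conj_exp p) n (\<lambda>k. sgn (t k)) \<le> 1"
      using True by (auto simp: ell_norm_def conj_exp_def abs_sgn_eq)
    moreover have "S powr (1 / p) = (\<Sum>k<n. sgn (t k) * t k)"
      using True S0 by (simp add: S_def mult.commute[of "sgn _"] flip: abs_sgn)
    ultimately show ?thesis by blast
  next
    case False
    then have p1: "1 < p" using p by simp
    show ?thesis
    proof (cases "S = 0")
      case True
      then show ?thesis by (intro exI[of _ "\<lambda>_. 0"]) (simp add: ell_norm_zero)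
    next
      case False
      with S0 have S: "0 < S" by simp
      define q where "q = p / (p - 1)"
      have q: "1 < q" "1 / q + 1 / p = 1" "(p - 1) * q = p" using p1 by (auto simp: q_def field_simps)
      \<comment> \<open>The equality case of Hoelder's inequality; \<open>(p - 1) * q = p\<close>
        makes its \<open>q\<close>-th power sum equal to 1.\<close>
      define a where "a k = sgn (t k) * \<bar>t k\<bar> powr (p - 1) / S powr (1 / q)" for k
      have abs_a: "\<bar>a k\<bar> powr q = \<bar>t k\<bar> powr p / S" for k
        using S q by (simp add: a_def abs_mult abs_sgn_eq powr_divide powr_powr)
      have "(\<Sum>k<n. \<bar>a k\<bar> powr q) = 1"
        using S by (simp add: abs_a flip: sum_divide_distrib S_def)
      then have "ell_norm (conj_exp p) n a \<le> 1"
        using p1 by (simp add: ell_norm_def conj_exp_def flip: q_def)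
      moreover have "(\<Sum>k<n. a k * t k) = S powr (1 / p)"
      proof -
        have "a k * t k = \<bar>t k\<bar> powr p / S powr (1 / q)" for k
        proof -
          have "a k * t k = \<bar>t k\<bar> * \<bar>t k\<bar> powr (p - 1) / S powr (1 / q)"
            unfolding a_def by (simp add: abs_sgn mult_ac)
          also have "\<bar>t k\<bar> * \<bar>t k\<bar> powr (p - 1) = \<bar>t k\<bar> powr p"
            by (cases "t k = 0") (simp_all add: powr_mult_base)
          finally show ?thesis .
        qed
        then have "(\<Sum>k<n. a k * t k) = S / S powr (1 / q)"
          by (simp add: S_def flip: sum_divide_distrib)
        moreover have "S = S powr (1 / p) * S powr (1 / q)"
          using S q by (simp flip: powr_add add: add.commute)
        ultimately show ?thesis using S by (simp add: divide_eq_eq)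
      qed
      ultimately show ?thesis by metis
    qed
  qed
  then obtain a where a: "ell_norm (conj_exp p) n a \<le> 1" "S powr (1 / p) = (\<Sum>k<n. a k * t k)"
    by blast
  have "S powr (1 / p) = blinfun_apply (\<Sum>k<n. a k *\<^sub>R z k) x"
    by (simp add: a t_def blinfun.sum_left blinfun.scaleR_left)
  also have "\<dots> \<le> norm (\<Sum>k<n. a k *\<^sub>R z k) * norm x"
    by (metis abs_le_D1 norm_blinfun real_norm_def)
  also have "\<dots> \<le> weak_norm p n z * norm x"
    by (intro mult_right_mono weak_norm_upper p a) auto
  also have "\<dots> \<le> (norm x + 1) * weak_norm p n z"
    using weak_norm_nonneg[OF p, of n z] by (simp add: algebra_simps)
  finally show "(\<Sum>k<n. \<bar>delta x (z k)\<bar> powr p) powr (1 / p) \<le> (norm x + 1) * weak_norm p n z"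
    by (simp add: S_def t_def delta_def)
qed

section \<open>From infimum norms to explicit constants\<close>

lemma fbl_norm_eq_summing_norm: "fbl_norm p f = summing_norm p f"
  by (simp add: fbl_norm_def summing_norm_def)

lemma fbl_norm_le:
  assumes "summing_bound p C f" "1 \<le> p"
  shows "fbl_norm p f \<le> ennreal C"
proof -
  have "0 < C" using assms by (simp add: summing_bound_def)
  with assms show ?thesis
    unfolding fbl_norm_def by (intro INF_lower) (auto simp: summing_bound_iff)
qed

text \<open>The strict inequality puts a nonnegative admissible constant below \<open>e\<close>,
  which also makes \<open>e\<close> positive.\<close>

lemma summing_bound_if_summing_norm_less:
  assumes "summing_norm p T < ennreal e" "1 \<le> p"
  shows "summing_bound p e (\<lambda>z. norm (T z))"
proof -
  obtain C where C: "0 \<le> C" "ennreal C < ennreal e"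
    and b: "\<And>n z. (\<Sum>k<n. norm (T (z k)) powr p) powr (1 / p) \<le> C * weak_norm p n z"
    using assms(1) unfolding summing_norm_def INF_less_iff by auto
  have e: "C < e" using C by (simp add: ennreal_less_iff)
  show ?thesis
    unfolding summing_bound_iff[OF assms(2) le_less_trans[OF C(1) e]]
  proof (intro allI)
    fix n and z :: "nat \<Rightarrow> 'a"
    have "C * weak_norm p n z \<le> e * weak_norm p n z"
      using e weak_norm_nonneg[OF assms(2)] by (intro mult_right_mono) auto
    with b[where n = n and z = z] show "(\<Sum>k<n. \<bar>norm (T (z k))\<bar> powr p) powr (1 / p) \<le> e * weak_norm p n z"
      by simp
  qed
qed

lemma summing_bound_if_fbl_norm_less:
  assumes "fbl_norm p f < ennreal e" "1 \<le> p"
  shows "summing_bound p e f"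
  using summing_bound_if_summing_norm_less[of p f e] assms
  by (auto simp: fbl_norm_eq_summing_norm intro: summing_bound_mono)

text \<open>A Chebyshev argument: both functions are small on average along their tuples.\<close>

lemma summing_bound_small_simultaneously:
  fixes D E :: "'z::real_normed_vector \<Rightarrow> real"
  assumes p: "1 \<le> p" and N: "0 < N" and "0 < \<eta>"
    and D: "summing_bound p B D" and E: "summing_bound p B' E"
    and z: "weak_norm p N z \<le> R * real N powr (1 / p)" "B * R \<le> \<eta> / 2"
    and w: "weak_norm p N w \<le> R' * real N powr (1 / p)" "B' * R' < \<eta> / 2"
  shows "\<exists>k<N. \<bar>D (z k)\<bar> < \<eta> \<and> \<bar>E (w k)\<bar> < \<eta>"
proof (rule ccontr)
  assume "\<not> ?thesis"
  then have big: "\<eta> \<le> \<bar>D (z k)\<bar> \<or> \<eta> \<le> \<bar>E (w k)\<bar>" if "k < N" for k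
    using that by (meson not_less)
  have avg: "(\<Sum>k<N. \<bar>f (x k)\<bar> powr p) \<le> N * (b * r) powr p"
    if "summing_bound p b f" "weak_norm p N x \<le> r * real N powr (1 / p)" 
    for b r and f :: "'z \<Rightarrow> real" and x
  proof -
    have b: "0 < b" using that by (simp add: summing_bound_def)
    have "(\<Sum>k<N. \<bar>f (x k)\<bar> powr p) \<le> (b * weak_norm p N x) powr p"
      using that by (auto simp: summing_bound_def)
    also have "\<dots> \<le> (b * (r * real N powr (1 / p))) powr p"
      using that p b by (intro powr_mono2 mult_left_mono mult_nonneg_nonneg weak_norm_nonneg) auto
    also have "\<dots> = N * (b * r) powr p"
      using p N by (simp add: powr_mult powr_powr mult_ac)
    finally show ?thesis .
  qed
  have pos: "0 \<le> b * r" if "0 < b" "weak_norm p N x \<le> r * real N powr (1 / p)" 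
    for b r and x :: "nat \<Rightarrow> 'z"
  proof -
    have "0 \<le> r * real N powr (1 / p)" using that weak_norm_nonneg[OF p, of N x] by linarith
    with N have "0 \<le> r" by (simp add: zero_le_mult_iff)
    with that show ?thesis by simp
  qed
  have half: "(\<eta> / 2) powr p \<le> \<eta> powr p / 2"
  proof -
    have "(2::real) powr 1 \<le> 2 powr p" using p by (intro powr_mono) auto
    then have "\<eta> powr p / 2 powr p \<le> \<eta> powr p / 2" by (intro divide_left_mono) auto
    then show ?thesis by (simp add: powr_divide)
  qed
  \<comment> \<open>If every index fails, the two power sums together reach
    \<open>N * \<eta> powr p\<close>; the averages keep them strictly below that, by
    \<open>half\<close> and the strict hypothesis on \<open>w\<close>.\<close>
  have "N * \<eta> powr p = (\<Sum>k<N. \<eta> powr p)" by simp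
  also have "\<dots> \<le> (\<Sum>k<N. \<bar>D (z k)\<bar> powr p + \<bar>E (w k)\<bar> powr p)"
  proof (intro sum_mono)
    fix k assume "k \<in> {..<N}"
    then consider "\<eta> \<le> \<bar>D (z k)\<bar>" | "\<eta> \<le> \<bar>E (w k)\<bar>" using big by auto
    then show "\<eta> powr p \<le> \<bar>D (z k)\<bar> powr p + \<bar>E (w k)\<bar> powr p"
    proof cases
      case 1
      then have "\<eta> powr p \<le> \<bar>D (z k)\<bar> powr p" using p \<open>0 < \<eta>\<close> by (intro powr_mono2) auto
      then show ?thesis by (simp add: add_increasing2)
    next
      case 2
      then have "\<eta> powr p \<le> \<bar>E (w k)\<bar> powr p" using p \<open>0 < \<eta>\<close> by (intro powr_mono2) auto
      then show ?thesis by (simp add: add_increasing)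
    qed
  qed
  also have "\<dots> \<le> N * (B * R) powr p + N * (B' * R') powr p"
    unfolding sum.distrib by (intro add_mono avg D E z w)
  also have "\<dots> < N * (\<eta> / 2) powr p + N * (\<eta> / 2) powr p"
  proof (intro add_le_less_mono mult_strict_left_mono mult_left_mono)
    show "(B * R) powr p \<le> (\<eta> / 2) powr p"
      using D z p by (intro powr_mono2 pos[of B z R]) (auto simp: summing_bound_def)
    show "(B' * R') powr p < (\<eta> / 2) powr p"
      using E w p by (intro powr_less_mono2 pos[of B' w R']) (auto simp: summing_bound_def)
  qed (use N in auto)
  also have "\<dots> \<le> N * \<eta> powr p" using mult_left_mono[OF half, of "real N"] by simp
  finally show False by simp
qed

section \<open>Linear functionals\<close>

lemma linear_combination_if_kernels_subset:
  assumes "finite I" "linear f" "\<And>i. i \<in> I \<Longrightarrow> linear (g i)"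
    and "\<And>v. (\<And>i. i \<in> I \<Longrightarrow> g i v = 0) \<Longrightarrow> f v = 0"
  shows "\<exists>c. \<forall>v. f v = (\<Sum>i\<in>I. c i * g i v :: real)"
  using assms
proof (induction I arbitrary: f rule: finite_induct)
  case empty
  then show ?case by simp
next
  case (insert j I)
  have lf: "linear f" and lj: "linear (g j)" using insert.prems by auto
  show ?case
  proof (cases "\<forall>v. (\<forall>i\<in>I. g i v = 0) \<longrightarrow> g j v = 0")
    case True
    have "\<exists>c. \<forall>v. f v = (\<Sum>i\<in>I. c i * g i v)"
      using True insert.prems by (intro insert.IH) auto
    then obtain c where "\<forall>v. f v = (\<Sum>i\<in>I. c i * g i v)" by blast
    then have "\<forall>v. f v = (\<Sum>i\<in>insert j I. (c(j := 0)) i * g i v)"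
      using insert.hyps by (auto intro!: sum.cong)
    then show ?thesis by blast
  next
    case False
    then obtain w where w: "\<And>i. i \<in> I \<Longrightarrow> g i w = 0" "g j w \<noteq> 0" by blast
    define r where "r = f w / g j w"
    have "\<exists>c. \<forall>v. f v - r * g j v = (\<Sum>i\<in>I. c i * g i v)"
    proof (rule insert.IH)
      show "linear (\<lambda>v. f v - r * g j v)"
        using linear_compose_sub[OF lf linear_compose_scale_right[OF lj, of r]] by simp
      show "linear (g i)" if "i \<in> I" for i using that insert.prems by auto
      fix v assume v: "\<And>i. i \<in> I \<Longrightarrow> g i v = 0"
      define v' where "v' = v - (g j v / g j w) *\<^sub>R w"
      have "f v' = 0"
      proof (rule insert.prems(3))
        fix i assume "i \<in> insert j I"
        then show "g i v' = 0"
          using w v insert.prems(2)[of i] by (auto simp: v'_def linear_diff linear_scale)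
      qed
      then show "f v - r * g j v = 0"
        using lf by (simp add: v'_def r_def linear_diff linear_scale mult.commute)
    qed
    then obtain c where c: "\<forall>v. f v - r * g j v = (\<Sum>i\<in>I. c i * g i v)" by blast
    have "f v = (\<Sum>i\<in>insert j I. (c(j := r)) i * g i v)" for v
    proof -
      have "(\<Sum>i\<in>I. (c(j := r)) i * g i v) = (\<Sum>i\<in>I. c i * g i v)"
        using insert.hyps by (intro sum.cong) auto
      then show ?thesis using c[rule_format, of v] insert.hyps by simp
    qed
    then show ?thesis by blast
  qed
qed

text \<open>A basic weak-star neighbourhood of 0 on which \<open>\<bar>\<phi>\<bar> < 1\<close>
  constrains only finitely many evaluations. On their common kernel \<open>\<phi>\<close> is bounded
  along every line through 0, hence zero, so it is a combination of these evaluations.\<close>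

lemma weak_star_functional_is_evaluation:
  fixes \<phi> :: "('a::real_normed_vector \<Rightarrow>\<^sub>L real) \<Rightarrow> real"
  assumes lin: "linear \<phi>" and cont: "continuous_map weak_star euclideanreal \<phi>"
  shows "\<exists>v. \<forall>\<xi>. \<phi> \<xi> = blinfun_apply \<xi> v"
proof -
  have "openin weak_star {\<xi> \<in> topspace weak_star. \<phi> \<xi> \<in> {-1<..<1}}"
    by (rule openin_continuous_map_preimage[OF cont]) simp
  then obtain U where U: "openin euclidean U" "{\<xi>. \<phi> \<xi> \<in> {-1<..<1}} = blinfun_apply -` U"
    unfolding strong_operator_topology_def
    by (auto simp: openin_pullback_topology topspace_pullback_topology)
  have "blinfun_apply 0 \<in> U" using U(2) linear_0[OF lin] by auto
  then obtain X where X: "blinfun_apply 0 \<in> Pi\<^sub>E UNIV X" "finite {v. X v \<noteq> UNIV}" "Pi\<^sub>E UNIV X \<subseteq> U"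
    using product_topology_open_contains_basis[of "\<lambda>_. euclidean" UNIV U "blinfun_apply 0"] U(1)
    by (auto simp: euclidean_product_topology)
  define I where "I = {v. X v \<noteq> UNIV}"
  have "\<exists>c. \<forall>\<xi>. \<phi> \<xi> = (\<Sum>v\<in>I. c v * blinfun_apply \<xi> v)"
  proof (rule linear_combination_if_kernels_subset[OF _ lin])
    show "finite I" using X by (simp add: I_def)
    show "linear (\<lambda>\<xi>. blinfun_apply \<xi> v)" for v :: 'a
      by (intro bounded_linear.linear blinfun.bounded_linear_left)
    fix \<xi> :: "'a \<Rightarrow>\<^sub>L real" assume "\<And>v. v \<in> I \<Longrightarrow> blinfun_apply \<xi> v = 0"
    then have "blinfun_apply (r *\<^sub>R \<xi>) \<in> Pi\<^sub>E UNIV X" for r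
      using X(1) by (fastforce simp: I_def PiE_iff blinfun.scaleR_left)
    then have "(r *\<^sub>R \<xi>) \<in> blinfun_apply -` U" for r
      unfolding vimage_eq using X(3) by (rule subsetD[rotated])
    then have "\<phi> (r *\<^sub>R \<xi>) \<in> {-1<..<1}" for r
      unfolding U(2)[symmetric] by simp
    then have small: "\<bar>r * \<phi> \<xi>\<bar> < 1" for r
      by (auto simp: linear_scale[OF lin] abs_less_iff minus_less_iff)
    show "\<phi> \<xi> = 0"
      using small[of "1 / \<phi> \<xi>"] by (cases "\<phi> \<xi> = 0") auto
  qed
  then obtain c where "\<forall>\<xi>. \<phi> \<xi> = (\<Sum>v\<in>I. c v * blinfun_apply \<xi> v)" by blast
  then have "\<forall>\<xi>. \<phi> \<xi> = blinfun_apply \<xi> (\<Sum>v\<in>I. c v *\<^sub>R v)"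
    by (simp add: blinfun.sum_right blinfun.scaleR_right)
  then show ?thesis by blast
qed

section \<open>The Hahn-Banach theorem\<close>

definition sublinear :: "('a::real_vector \<Rightarrow> real) \<Rightarrow> bool"
  where "sublinear q \<longleftrightarrow> (\<forall>x y. q (x + y) \<le> q x + q y) \<and> (\<forall>r\<ge>0. \<forall>x. q (r *\<^sub>R x) = r * q x)"

lemma sublinear_lower:
  assumes "sublinear q"
  shows "- q (- x) \<le> q x"
proof -
  have "q (x + - x) \<le> q x + q (- x)" using assms unfolding sublinear_def by blast
  moreover have "q (0 *\<^sub>R x) = 0 * q x" using assms unfolding sublinear_def by blast
  ultimately show ?thesis by simp
qed

text \<open>For sublinear \<open>q\<close> this lies below \<open>q\<close> (take
  \<open>t = 0\<close>) and is at most \<open>- q v\<close> at \<open>- v\<close> (take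
  \<open>t = 1\<close>), so a linear functional below it is at least \<open>q v\<close> at
  \<open>v\<close>.\<close>

definition depress :: "'a::real_vector \<Rightarrow> ('a \<Rightarrow> real) \<Rightarrow> 'a \<Rightarrow> real"
  where "depress v q x = (INF t\<in>{0..}. q (x + t *\<^sub>R v) - t * q v)"

lemma depress:
  assumes q: "sublinear q"
  shows sublinear_depress: "sublinear (depress v q)"
    and depress_le: "0 \<le> t \<Longrightarrow> depress v q x \<le> q (x + t *\<^sub>R v) - t * q v"
proof -
  have add: "q (x + y) \<le> q x + q y" for x y using q by (auto simp: sublinear_def)
  have scale: "0 \<le> r \<Longrightarrow> q (r *\<^sub>R x) = r * q x" for r x using q by (auto simp: sublinear_def)
  have "- q (- x) \<le> q (x + t *\<^sub>R v) - t * q v" if "0 \<le> t" for t x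
  proof -
    have "t * q v \<le> q (x + t *\<^sub>R v) + q (- x)"
      using add[of "x + t *\<^sub>R v" "- x"] scale[OF that, of v] by simp
    then show ?thesis by simp
  qed
  then have bdd: "bdd_below ((\<lambda>t. q (x + t *\<^sub>R v) - t * q v) ` {0..})" for x
    by (intro bdd_belowI2) auto
  show le: "0 \<le> t \<Longrightarrow> depress v q x \<le> q (x + t *\<^sub>R v) - t * q v" for t x
    unfolding depress_def using bdd by (intro cINF_lower) auto
  have ge: "B \<le> depress v q x" if "\<And>t. 0 \<le> t \<Longrightarrow> B \<le> q (x + t *\<^sub>R v) - t * q v" for B x
    unfolding depress_def using that by (intro cINF_greatest) auto
  have pos: "depress v q (r *\<^sub>R x) \<le> r * depress v q x" if "0 < r" for r x
  proof -
    have "depress v q (r *\<^sub>R x) / r \<le> depress v q x"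
    proof (rule ge)
      fix t :: real assume "0 \<le> t"
      then have "depress v q (r *\<^sub>R x) \<le> q (r *\<^sub>R x + (r * t) *\<^sub>R v) - (r * t) * q v"
        using that by (intro le) auto
      also have "\<dots> = r * (q (x + t *\<^sub>R v) - t * q v)"
        using scale[of r "x + t *\<^sub>R v"] that by (simp add: algebra_simps)
      finally show "depress v q (r *\<^sub>R x) / r \<le> q (x + t *\<^sub>R v) - t * q v"
        using that by (simp add: field_simps)
    qed
    then show ?thesis using that by (simp add: field_simps)
  qed
  show "sublinear (depress v q)"
    unfolding sublinear_def
  proof (intro conjI allI impI)
    fix x y
    have "depress v q (x + y) - (q (y + t *\<^sub>R v) - t * q v) \<le> depress v q x" if t: "0 \<le> t" for t
    proof (rule ge)
      fix s :: real assume s: "0 \<le> s"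
      have "depress v q (x + y) \<le> q ((x + y) + (s + t) *\<^sub>R v) - (s + t) * q v"
        using s t by (intro le) auto
      moreover have "q ((x + s *\<^sub>R v) + (y + t *\<^sub>R v)) \<le> q (x + s *\<^sub>R v) + q (y + t *\<^sub>R v)" by (rule add)
      ultimately show "depress v q (x + y) - (q (y + t *\<^sub>R v) - t * q v) \<le> q (x + s *\<^sub>R v) - s * q v"
        by (simp add: algebra_simps)
    qed
    then have "depress v q (x + y) - depress v q x \<le> depress v q y"
      by (intro ge) (auto simp: algebra_simps)
    then show "depress v q (x + y) \<le> depress v q x + depress v q y" by simp
  next
    fix r :: real and x assume "0 \<le> r"
    then consider "r = 0" | "0 < r" by linarith
    then show "depress v q (r *\<^sub>R x) = r * depress v q x"
    proof cases
      case 1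
      have "depress v q 0 \<le> 0" using le[of 0 0] scale[of 0 0] by simp
      moreover have "0 \<le> depress v q 0" using scale by (intro ge) auto
      ultimately show ?thesis using 1 by simp
    next
      case 2
      have "r * depress v q x \<le> depress v q (r *\<^sub>R x)"
        using pos[of "1 / r" "r *\<^sub>R x"] 2 by (simp add: field_simps)
      then show ?thesis using pos[OF 2, of x] by simp
    qed
  qed
qed

text \<open>The Hahn-Banach theorem, obtained from a minimal sublinear functional \<open>q\<close> below \<open>P\<close>:
  minimality gives \<open>depress v q = q\<close>, and this is superadditivity of \<open>q\<close>.\<close>

lemma linear_below_sublinear:
  assumes P: "sublinear (P :: 'a::real_vector \<Rightarrow> real)"
  shows "\<exists>q. linear q \<and> (\<forall>x. q x \<le> P x)"
proof -
  define A where "A = {q. sublinear q \<and> q \<le> P}"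
  \<comment> \<open>The order is reversed, so that Zorn's lemma yields a minimal functional.\<close>
  let ?R = "relation_of (\<lambda>q r. r \<le> q) A"
  have "\<exists>m\<in>A. \<forall>q\<in>A. q \<le> m \<longrightarrow> q = m"
  proof (rule predicate_Zorn)
    show "partial_order_on A ?R"
      by (auto simp: partial_order_on_def preorder_on_def refl_on_def trans_def antisym_def relation_of_def)
    fix C assume C: "C \<in> Chains ?R"
    show "\<exists>u\<in>A. \<forall>q\<in>C. u \<le> q"
    proof (cases "C = {}")
      case True
      then show ?thesis using P by (auto simp: A_def)
    next
      case False
      have CA: "q \<in> A" if "q \<in> C" for q using C that by (auto simp: Chains_def relation_of_def)
      have sub: "sublinear q" if "q \<in> C" for q using CA[OF that] by (simp add: A_def)
      have chain: "q \<le> r \<or> r \<le> q" if "q \<in> C" "r \<in> C" for q r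
        using C that by (auto simp: Chains_def relation_of_def)
      have low: "- P (- x) \<le> q x" if "q \<in> C" for q x
      proof -
        have "q (- x) \<le> P (- x)" using CA[OF that] by (simp add: A_def le_fun_def)
        then show ?thesis using sublinear_lower[OF sub[OF that], of x] by simp
      qed
      define u where "u x = (INF q\<in>C. q x)" for x
      have bdd: "bdd_below ((\<lambda>q. q x) ` C)" for x
        using low by (intro bdd_belowI2) auto
      have le: "u x \<le> q x" if "q \<in> C" for q x
        unfolding u_def using bdd that by (rule cINF_lower)
      have ge: "B \<le> u x" if "\<And>q. q \<in> C \<Longrightarrow> B \<le> q x" for B x
        unfolding u_def using False that by (intro cINF_greatest) auto
      have "sublinear u"
        unfolding sublinear_def
      proof (intro conjI allI impI)
        fix x y
        \<comment> \<open>Two members of the chain are comparable, and the smaller one bounds both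
          values at once; this makes the pointwise infimum subadditive.\<close>
        have key: "u (x + y) \<le> q x + r y" if qr: "q \<in> C" "r \<in> C" for q r
        proof -
          obtain s where s: "s \<in> C" "s x \<le> q x" "s y \<le> r y"
            using chain[OF qr] qr by (auto simp: le_fun_def)
          have "u (x + y) \<le> s (x + y)" by (rule le[OF s(1)])
          also have "\<dots> \<le> s x + s y" using sub[OF s(1)] by (auto simp: sublinear_def)
          finally show ?thesis using s by simp
        qed
        have "u (x + y) - r y \<le> u x" if "r \<in> C" for r
          using key that by (intro ge) (auto simp: algebra_simps)
        then have "u (x + y) - u x \<le> u y" by (intro ge) (auto simp: algebra_simps)
        then show "u (x + y) \<le> u x + u y" by simp
      next
        fix r :: real and x assume r: "0 \<le> r"
        have eq: "q (r *\<^sub>R x) = r * q x" if "q \<in> C" for q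
          using sub[OF that] r by (auto simp: sublinear_def)
        consider "r = 0" | "0 < r" using r by linarith
        then show "u (r *\<^sub>R x) = r * u x"
        proof cases
          case 1
          have "(\<lambda>q. q (r *\<^sub>R x)) ` C = {0}" using False eq 1 by (auto simp: image_iff)
          then show ?thesis using 1 by (simp add: u_def)
        next
          case 2
          have "r * u x \<le> u (r *\<^sub>R x)"
            using le r by (intro ge) (auto simp: eq intro: mult_left_mono)
          moreover have "u (r *\<^sub>R x) / r \<le> u x"
            using le[of _ "r *\<^sub>R x"] 2 by (intro ge) (auto simp: eq divide_le_eq mult.commute)
          ultimately show ?thesis using 2 by (simp add: field_simps)
        qed
      qed
      moreover have "u \<le> P"
        using False CA le by (fastforce simp: A_def le_fun_def intro: order_trans)
      ultimately show ?thesis using le by (auto simp: A_def le_fun_def)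
    qed
  qed
  then obtain m where m: "sublinear m" "m \<le> P" and min: "\<And>q. sublinear q \<Longrightarrow> q \<le> m \<Longrightarrow> q = m"
    unfolding A_def by (auto intro: order_trans)
  have superadd: "m x + m v \<le> m (x + v)" for x v
  proof -
    have "depress v m \<le> m"
      using depress_le[OF m(1), of 0 v] by (auto simp: le_fun_def)
    then have "depress v m = m" by (rule min[OF sublinear_depress[OF m(1)]])
    then show ?thesis using depress_le[OF m(1), of 1 v x] by simp
  qed
  have add: "m (x + y) = m x + m y" for x y
    using superadd[of x y] m(1) by (auto simp: sublinear_def intro: order_antisym)
  have pos: "0 \<le> r \<Longrightarrow> m (r *\<^sub>R x) = r * m x" for r x using m(1) by (auto simp: sublinear_def)
  have neg: "m (- x) = - m x" for x using add[of x "- x"] pos[of 0 x] by simp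
  have "m (r *\<^sub>R x) = r * m x" for r x
    using pos[of r x] pos[of "- r" x] neg[of "r *\<^sub>R x"] by (cases "0 \<le> r") auto
  then have "linear m" by (intro linearI add) auto
  then show ?thesis using m(2) by (auto simp: le_fun_def)
qed

text \<open>Hahn-Banach below \<open>depress v norm\<close> instead of \<open>norm\<close>: the
  functional is still dominated by the norm, and its value at \<open>v\<close> is forced to be at
  least \<open>norm v\<close>.\<close>

lemma ex_functional_nonzero:
  fixes v :: "'a::real_normed_vector"
  assumes "v \<noteq> 0"
  shows "\<exists>y :: 'a \<Rightarrow>\<^sub>L real. blinfun_apply y v \<noteq> 0"
proof -
  have sn: "sublinear (norm :: 'a \<Rightarrow> real)" by (auto simp: sublinear_def norm_triangle_ineq)
  obtain q where q: "linear q" "\<And>x. q x \<le> depress v norm x"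
    using linear_below_sublinear[OF sublinear_depress[OF sn]] by blast
  have le: "q x \<le> norm x" for x
    using order_trans[OF q(2) depress_le[OF sn, of 0 v x]] by simp
  have "\<bar>q x\<bar> \<le> norm x" for x
    using le[of x] le[of "- x"] linear_neg[OF q(1), of x] by simp
  then have bl: "bounded_linear q"
    using q(1) by (intro bounded_linear_intro[of _ 1]) (auto simp: linear_add linear_scale)
  have "q (- v) \<le> - norm v"
    using order_trans[OF q(2) depress_le[OF sn, of 1 v "- v"]] by simp
  with assms have "q v \<noteq> 0" by (auto simp: linear_neg[OF q(1)])
  then show ?thesis using bl by (intro exI[of _ "Blinfun q"]) (simp add: bounded_linear_Blinfun_apply)
qed

section \<open>Sign vectors\<close>

text \<open>Binary digits as signs: for \<open>k < 2 ^ s\<close> the vectors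
  \<open>sign_bit j k\<close>, \<open>j < s\<close>, run once through all sign vectors of length
  \<open>s\<close>.\<close>

definition sign_bit :: "nat \<Rightarrow> nat \<Rightarrow> real"
  where "sign_bit j k = (if odd (k div 2 ^ j) then - 1 else 1)"

lemma abs_sign_bit [simp]: "\<bar>sign_bit j k\<bar> = 1"
  by (simp add: sign_bit_def)

lemma sign_bit_shift:
  assumes "j < s"
  shows "sign_bit j (k + 2 ^ s) = sign_bit j k"
proof -
  obtain d where "s = Suc (j + d)" using assms less_iff_Suc_add by auto
  then have "(2::nat) ^ s = (2 * 2 ^ d) * 2 ^ j" by (simp add: power_add)
  then have "(k + 2 ^ s) div 2 ^ j = k div 2 ^ j + 2 * 2 ^ d"
    by (simp only: div_mult_self1) simp
  then show ?thesis by (simp add: sign_bit_def)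
qed

lemma sign_bit_high:
  assumes "k < 2 ^ s"
  shows "sign_bit s k = 1" "sign_bit s (k + 2 ^ s) = - 1"
  using assms by (simp_all add: sign_bit_def)

lemma sum_lessThan_add: "(\<Sum>k<m + n. f k) = (\<Sum>k<m. f k) + (\<Sum>k<n. f (k + m) :: real)" for m n :: nat
  by (induction n) (simp_all add: add_ac)

text \<open>Independence of the signs makes the exponential moment factorise. The induction splits
  the range at \<open>2 ^ s\<close>, where digit \<open>s\<close> changes and the lower digits
  repeat.\<close>

lemma sum_exp_sign_bit:
  "(\<Sum>k<2 ^ s. exp (\<Sum>j<s. b j * sign_bit j k)) = (\<Prod>j<s. exp (b j) + exp (- b j))"
proof (induction s)
  case 0
  then show ?case by simp
next
  case (Suc s)
  have low: "(\<Sum>j<Suc s. b j * sign_bit j k) = (\<Sum>j<s. b j * sign_bit j k) + b s"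
    if "k < 2 ^ s" for k
    using that by (simp add: sign_bit_high)
  have high: "(\<Sum>j<Suc s. b j * sign_bit j (k + 2 ^ s)) = (\<Sum>j<s. b j * sign_bit j k) + - b s"
    if "k < 2 ^ s" for k
    using that by (simp add: sign_bit_high sign_bit_shift)
  have "(\<Sum>k<2 ^ Suc s. exp (\<Sum>j<Suc s. b j * sign_bit j k))
    = (\<Sum>k<2 ^ s. exp (\<Sum>j<Suc s. b j * sign_bit j k))
      + (\<Sum>k<2 ^ s. exp (\<Sum>j<Suc s. b j * sign_bit j (k + 2 ^ s)))"
    using sum_lessThan_add[of _ "2 ^ s" "2 ^ s"] by (simp add: mult_2)
  also have "\<dots> = (\<Sum>k<2 ^ s. exp (\<Sum>j<s. b j * sign_bit j k) * exp (b s))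
      + (\<Sum>k<2 ^ s. exp (\<Sum>j<s. b j * sign_bit j k) * exp (- b s))"
    by (intro arg_cong2[where f = "(+)"] sum.cong refl, simp_all only: low high lessThan_iff exp_add)
  also have "\<dots> = (\<Sum>k<2 ^ s. exp (\<Sum>j<s. b j * sign_bit j k)) * (exp (b s) + exp (- b s))"
    by (simp add: sum_distrib_right distrib_left)
  finally show ?case using Suc by simp
qed

text \<open>The difference \<open>x\<^sup>2 / 2 - ln (cosh x)\<close> has derivative
  \<open>x - tanh x\<close>, which is nonnegative for \<open>x \<ge> 0\<close>; evenness covers
  negative \<open>x\<close>.\<close>

lemma exp_add_exp_minus_le: "exp x + exp (- x) \<le> 2 * exp (x\<^sup>2 / 2)" for x :: real
proof -
  define f where "f x = x\<^sup>2 / 2 - ln (cosh x)" for x :: real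
  have nonneg: "f 0 \<le> f x" if "0 \<le> x" for x
  proof (rule DERIV_nonneg_imp_nondecreasing[OF that])
    fix y :: real assume y: "0 \<le> y"
    have "(f has_real_derivative (y - tanh y)) (at y)"
      unfolding f_def using cosh_real_pos[of y]
      by (auto intro!: derivative_eq_intros simp: tanh_def)
    moreover have "tanh y \<le> y"
    proof -
      have "0 - tanh 0 \<le> y - tanh y"
      proof (rule DERIV_nonneg_imp_nondecreasing[OF y])
        fix z :: real
        have "((\<lambda>z. z - tanh z) has_real_derivative (1 - (1 - tanh z ^ 2))) (at z)"
          by (auto intro!: derivative_eq_intros)
        then show "\<exists>d. ((\<lambda>z. z - tanh z) has_real_derivative d) (at z) \<and> 0 \<le> d"
          by (auto intro!: exI)
      qed
      then show ?thesis by simp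
    qed
    ultimately show "\<exists>d. (f has_real_derivative d) (at y) \<and> 0 \<le> d" by auto
  qed
  have "0 \<le> f \<bar>x\<bar>" using nonneg[of "\<bar>x\<bar>"] by (simp add: f_def)
  then have "ln (cosh x) \<le> x\<^sup>2 / 2" by (simp add: f_def)
  then have "exp (ln (cosh x)) \<le> exp (x\<^sup>2 / 2)" by (simp only: exp_le_cancel_iff)
  then have "cosh x \<le> exp (x\<^sup>2 / 2)" using cosh_real_pos[of x] by (simp only: exp_ln)
  then show ?thesis by (simp add: cosh_def)
qed

text \<open>This is \<open>u \<le> exp u\<close> for \<open>u = \<bar>t\<bar> / p\<close>, raised to
  the power \<open>p\<close>.\<close>

lemma powr_le_exp_abs:
  fixes p t :: real
  assumes "1 \<le> p"
  shows "\<bar>t\<bar> powr p \<le> p powr p * (exp t + exp (- t))"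
proof -
  have "\<bar>t\<bar> / p \<le> exp (\<bar>t\<bar> / p)" using exp_ge_add_one_self[of "\<bar>t\<bar> / p"] by linarith
  then have "(\<bar>t\<bar> / p) powr p \<le> exp (\<bar>t\<bar> / p) powr p" using assms by (intro powr_mono2) auto
  then have "\<bar>t\<bar> powr p \<le> p powr p * exp \<bar>t\<bar>"
    using assms by (simp add: powr_divide divide_le_eq exp_powr_real mult.commute)
  also have "\<dots> \<le> p powr p * (exp t + exp (- t))"
    by (intro mult_left_mono) (auto simp: abs_if)
  finally show ?thesis .
qed

text \<open>The 2 counts the exponentials of both signs, \<open>p powr p\<close> comes from
  \<open>powr_le_exp_abs\<close>, and \<open>exp (1 / 2)\<close> bounds the mean exponential moment
  for a vector of the Euclidean unit ball.\<close>

definition khintchine_const :: "real \<Rightarrow> real"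
  where "khintchine_const p = 2 * p powr p * exp (1 / 2)"

text \<open>The upper Khintchine estimate: powers are dominated by exponentials, whose averages over
  the signs are bounded independently of \<open>s\<close>.\<close>

lemma khintchine:
  assumes p: "1 \<le> p" and b: "(\<Sum>j<s. (b j)\<^sup>2) \<le> 1"
  shows "(\<Sum>k<2 ^ s. \<bar>\<Sum>j<s. b j * sign_bit j k\<bar> powr p) \<le> 2 ^ s * khintchine_const p"
proof -
  have *: "(\<Sum>k<2 ^ s. exp (\<Sum>j<s. c j * sign_bit j k)) \<le> 2 ^ s * exp (1 / 2)"
    if c: "(\<Sum>j<s. (c j)\<^sup>2) \<le> 1" for c
  proof -
    have "(\<Sum>k<2 ^ s. exp (\<Sum>j<s. c j * sign_bit j k)) \<le> (\<Prod>j<s. 2 * exp ((c j)\<^sup>2 / 2))"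
      unfolding sum_exp_sign_bit by (intro prod_mono) (auto simp: exp_add_exp_minus_le add_nonneg_nonneg)
    also have "\<dots> = 2 ^ s * exp (\<Sum>j<s. (c j)\<^sup>2 / 2)"
      by (simp add: prod.distrib exp_sum)
    also have "\<dots> \<le> 2 ^ s * exp (1 / 2)"
      using c by (simp flip: sum_divide_distrib)
    finally show ?thesis .
  qed
  have "(\<Sum>k<2 ^ s. \<bar>\<Sum>j<s. b j * sign_bit j k\<bar> powr p)
    \<le> (\<Sum>k<2 ^ s. p powr p * (exp (\<Sum>j<s. b j * sign_bit j k) + exp (- (\<Sum>j<s. b j * sign_bit j k))))"
    by (intro sum_mono powr_le_exp_abs p)
  also have "\<dots> = p powr p * ((\<Sum>k<2 ^ s. exp (\<Sum>j<s. b j * sign_bit j k))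
      + (\<Sum>k<2 ^ s. exp (\<Sum>j<s. (- b j) * sign_bit j k)))"
    by (simp add: sum_distrib_left sum.distrib distrib_left sum_negf)
  also have "\<dots> \<le> p powr p * (2 ^ s * exp (1 / 2) + 2 ^ s * exp (1 / 2))"
    using b by (intro mult_left_mono add_mono *) auto
  finally show ?thesis by (simp add: khintchine_const_def mult_ac)
qed

text \<open>Summing over \<open>k\<close> first turns \<open>a\<close> into coefficients
  \<open>d\<close> of the \<open>V j\<close>, so the Euclidean norm \<open>r\<close> of
  \<open>d\<close> has to be bounded. Pairing \<open>d\<close> with its own direction
  \<open>b\<close> gives a sum of \<open>a k\<close> times Rademacher sums, to which
  \<open>sum_conj_le\<close> and Khintchine's inequality apply.\<close>

lemma weak_norm_signs:
  assumes p: "1 \<le> p" and c: "0 \<le> c"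
    and V: "\<And>a. norm (\<Sum>j<s. a j *\<^sub>R V j) \<le> c * sqrt (\<Sum>j<s. (a j)\<^sup>2)"
  shows "weak_norm p (2 ^ s) (\<lambda>k. \<Sum>j<s. sign_bit j k *\<^sub>R V j)
    \<le> c * (1 + khintchine_const p) * real (2 ^ s) powr (1 / p)"
proof (rule weak_norm_le)
  fix a assume a: "ell_norm (conj_exp p) (2 ^ s) a \<le> 1"
  define d where "d j = (\<Sum>k<2 ^ s. a k * sign_bit j k)" for j
  define r where "r = sqrt (\<Sum>j<s. (d j)\<^sup>2)"
  have r0: "0 \<le> r" and r2: "r\<^sup>2 = (\<Sum>j<s. (d j)\<^sup>2)"
    by (simp_all add: r_def sum_nonneg)
  have r: "r \<le> (1 + khintchine_const p) * real (2 ^ s) powr (1 / p)"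
  proof (cases "r = 0")
    case True
    have "0 \<le> khintchine_const p" by (simp add: khintchine_const_def)
    then show ?thesis using True by simp
  next
    case False
    define b where "b j = d j / r" for j
    have b1: "(\<Sum>j<s. (b j)\<^sup>2) = 1"
      using False by (simp add: b_def power_divide flip: sum_divide_distrib r2)
    define t where "t k = \<bar>\<Sum>j<s. b j * sign_bit j k\<bar>" for k
    have "r = (\<Sum>j<s. b j * d j)"
      using False by (simp add: b_def power2_eq_square flip: sum_divide_distrib r2)
        (simp add: r2[unfolded power2_eq_square, symmetric])
    also have "\<dots> = (\<Sum>k<2 ^ s. a k * (\<Sum>j<s. b j * sign_bit j k))"
      unfolding d_def sum_distrib_left by (subst sum.swap) (simp add: mult_ac)
    also have "\<dots> \<le> (\<Sum>k<2 ^ s. \<bar>a k\<bar> * t k)"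
      by (intro sum_mono) (simp add: t_def flip: abs_mult)
    also have "\<dots> \<le> real (2 ^ s) powr (1 / p) * (1 + (\<Sum>k<2 ^ s. t k powr p) / real (2 ^ s))"
      by (intro sum_conj_le p a) (auto simp: t_def)
    also have "\<dots> \<le> real (2 ^ s) powr (1 / p) * (1 + khintchine_const p)"
      using khintchine[OF p, where s = s and b = b] b1
      by (intro mult_left_mono add_left_mono) (auto simp: t_def divide_le_eq mult.commute)
    finally show ?thesis by (simp add: mult.commute)
  qed
  have "(\<Sum>k<2 ^ s. a k *\<^sub>R (\<Sum>j<s. sign_bit j k *\<^sub>R V j)) = (\<Sum>j<s. d j *\<^sub>R V j)"
    unfolding d_def scaleR_sum_right scaleR_sum_left by (subst sum.swap) simp
  also have "norm \<dots> \<le> c * r" unfolding r_def by (rule V)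
  also have "\<dots> \<le> c * ((1 + khintchine_const p) * real (2 ^ s) powr (1 / p))"
    using c r by (rule mult_left_mono[rotated])
  finally show "norm (\<Sum>k<2 ^ s. a k *\<^sub>R (\<Sum>j<s. sign_bit j k *\<^sub>R V j))
    \<le> c * (1 + khintchine_const p) * real (2 ^ s) powr (1 / p)" by (simp add: mult_ac)
qed

section \<open>Free vector lattices\<close>

lemma sup_real_fun: "sup f g = (\<lambda>\<xi>. max (f \<xi>) (g \<xi> :: real))"
  and inf_real_fun: "inf f g = (\<lambda>\<xi>. min (f \<xi>) (g \<xi> :: real))"
  by (simp_all add: fun_eq_iff sup_max inf_min)

lemma Hw_zero: "f \<in> Hw \<Longrightarrow> f 0 = 0"
  using mult_zero_left[of "f 0"] by (auto simp: Hw_def dest!: spec[of _ "0::real"])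

lemma delta_in_Hw: "delta x \<in> Hw"
  using strong_operator_topology_continuous_evaluation[of x]
  by (auto simp: Hw_def delta_def[abs_def] blinfun.scaleR_left intro!: continuous_map_from_subtopology)

lemma vector_sublattice_Hw: "vector_sublattice (Hw :: (('a::real_normed_vector \<Rightarrow>\<^sub>L real) \<Rightarrow> real) set)"
  unfolding vector_sublattice_def sup_real_fun inf_real_fun
proof (intro conjI ballI allI)
  fix f g :: "('a \<Rightarrow>\<^sub>L real) \<Rightarrow> real" and r :: real
  assume f: "f \<in> Hw"
  show "(\<lambda>\<xi>. r * f \<xi>) \<in> Hw"
    using f unfolding Hw_def by (auto intro!: continuous_intros)
  assume g: "g \<in> Hw"
  show "(\<lambda>\<xi>. f \<xi> + g \<xi>) \<in> Hw" "(\<lambda>\<xi>. max (f \<xi>) (g \<xi>)) \<in> Hw" "(\<lambda>\<xi>. min (f \<xi>) (g \<xi>)) \<in> Hw"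
    using f g unfolding Hw_def
    by (auto simp: max_mult_distrib_left min_mult_distrib_left distrib_left intro!: continuous_intros)
qed (simp add: Hw_def)

lemma FVL_induct:
  assumes "\<And>x. delta x \<in> L" "L \<subseteq> Hw" "vector_sublattice L"
  shows "FVL \<subseteq> L"
  unfolding FVL_def using assms by (intro hull_minimal) auto

lemma FVL_subset_Hw: "FVL \<subseteq> Hw"
  by (rule FVL_induct) (auto simp: delta_in_Hw vector_sublattice_Hw)

lemma delta_in_FVL: "delta x \<in> FVL"
  unfolding FVL_def by (rule hull_inc) simp

lemma vector_sublattice_FVL: "vector_sublattice FVL"
  unfolding FVL_def hull_def by (auto simp: vector_sublattice_def)

lemma FVL_zero: "(\<lambda>_. 0) \<in> FVL"
  and FVL_add: "f \<in> FVL \<Longrightarrow> g \<in> FVL \<Longrightarrow> (\<lambda>\<xi>. f \<xi> + g \<xi>) \<in> FVL"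
  and FVL_scale: "f \<in> FVL \<Longrightarrow> (\<lambda>\<xi>. r * f \<xi>) \<in> FVL"
  and FVL_max: "f \<in> FVL \<Longrightarrow> g \<in> FVL \<Longrightarrow> (\<lambda>\<xi>. max (f \<xi>) (g \<xi>)) \<in> FVL"
  using vector_sublattice_FVL unfolding vector_sublattice_def sup_real_fun by blast+

lemma FVL_minus: "f \<in> FVL \<Longrightarrow> (\<lambda>\<xi>. - f \<xi>) \<in> FVL"
  using FVL_scale[of f "- 1"] by simp

lemma FVL_abs: "f \<in> FVL \<Longrightarrow> (\<lambda>\<xi>. \<bar>f \<xi>\<bar>) \<in> FVL"
proof -
  have "(\<lambda>\<xi>. \<bar>f \<xi>\<bar>) = (\<lambda>\<xi>. max (f \<xi>) (- f \<xi>))" by (auto simp: fun_eq_iff)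
  then show "f \<in> FVL \<Longrightarrow> (\<lambda>\<xi>. \<bar>f \<xi>\<bar>) \<in> FVL" using FVL_max[OF _ FVL_minus, of f f] by simp
qed

lemma FVL_sum: "(\<And>k. f k \<in> FVL) \<Longrightarrow> (\<lambda>\<xi>. \<Sum>k<n. f k \<xi>) \<in> FVL" for n :: nat
  by (induction n) (auto intro: FVL_zero FVL_add)

lemma bar_FVL:
  assumes "f \<in> FVL"
  shows "bar i f \<in> FVL"
proof -
  have "FVL \<subseteq> {f \<in> Hw. bar i f \<in> FVL}"
  proof (rule FVL_induct)
    have "bar i (delta x) = delta (blinfun_apply i x)" for x
      by (simp add: bar_def delta_def adj_def fun_eq_iff)
    then show "delta x \<in> {f \<in> Hw. bar i f \<in> FVL}" for x
      by (simp add: delta_in_Hw delta_in_FVL)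
    show "vector_sublattice {f \<in> Hw. bar i f \<in> FVL}"
      using vector_sublattice_Hw vector_sublattice_FVL
      by (auto simp: vector_sublattice_def bar_def sup_real_fun inf_real_fun)
  qed auto
  then show ?thesis using assms by auto
qed

text \<open>Increments of \<open>f\<close> are controlled by a \<open>p\<close>-summing function of
  the increment alone, uniformly in the base point; this permits averaging over translates.
  Generators are controlled by \<open>\<bar>delta x\<bar>\<close>, and for sums, maxima and minima
  the controls add.\<close>

lemma FVL_lipschitz:
  fixes f :: "('a::real_normed_vector \<Rightarrow>\<^sub>L real) \<Rightarrow> real"
  assumes p: "1 \<le> p" and f: "f \<in> FVL"
  shows "\<exists>B D. summing_bound p B D \<and> (\<forall>\<xi> \<zeta>. \<bar>f (\<xi> + \<zeta>) - f \<xi>\<bar> \<le> D \<zeta>)"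
proof -
  let ?P = "\<lambda>f :: ('a \<Rightarrow>\<^sub>L real) \<Rightarrow> real. \<exists>B D. summing_bound p B D \<and> (\<forall>\<xi> \<zeta>. \<bar>f (\<xi> + \<zeta>) - f \<xi>\<bar> \<le> D \<zeta>)"
  have "FVL \<subseteq> {f \<in> Hw. ?P f}"
  proof (rule FVL_induct)
    fix x :: 'a
    have "summing_bound p (norm x + 1) (\<lambda>\<xi>. \<bar>delta x \<xi>\<bar>)"
      by (rule summing_bound_mono[OF summing_bound_delta[OF p]]) (auto simp: p)
    then have "?P (delta x)"
      by (intro exI[of _ "norm x + 1"] exI[of _ "\<lambda>\<xi>. \<bar>delta x \<xi>\<bar>"]) (simp add: delta_def blinfun.add_left)
    then show "delta x \<in> {f \<in> Hw. ?P f}" by (simp add: delta_in_Hw)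
  next
    have 0: "?P (\<lambda>_. 0)"
      using summing_bound_mono[OF summing_bound_delta[OF p, of 0], of "\<lambda>_. 0"] p
      by (intro exI[of _ 1] exI[of _ "\<lambda>_. 0"]) auto
    have scale: "?P (\<lambda>\<xi>. r * f \<xi>)" if Pf: "?P f" for r f
    proof -
      obtain B D where BD: "summing_bound p B D" "\<And>\<xi> \<zeta>. \<bar>f (\<xi> + \<zeta>) - f \<xi>\<bar> \<le> D \<zeta>" using Pf by blast
      have "0 < B" using BD by (simp add: summing_bound_def)
      then have "summing_bound p ((\<bar>r\<bar> + 1) * B) (\<lambda>\<xi>. \<bar>r\<bar> * D \<xi>)"
        using p by (intro summing_bound_scale[OF BD(1)]) (auto simp: algebra_simps add_pos_nonneg)
      moreover have "\<bar>r * f (\<xi> + \<zeta>) - r * f \<xi>\<bar> \<le> \<bar>r\<bar> * D \<zeta>" for \<xi> \<zeta>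
        using mult_left_mono[OF BD(2), of "\<bar>r\<bar>"] by (simp add: right_diff_distrib flip: abs_mult)
      ultimately show ?thesis by blast
    qed
    have both: "?P (\<lambda>\<xi>. f \<xi> + g \<xi>) \<and> ?P (\<lambda>\<xi>. max (f \<xi>) (g \<xi>)) \<and> ?P (\<lambda>\<xi>. min (f \<xi>) (g \<xi>))"
      if Pf: "?P f" and Pg: "?P g" for f g
    proof -
      obtain B D where BD: "summing_bound p B D" "\<And>\<xi> \<zeta>. \<bar>f (\<xi> + \<zeta>) - f \<xi>\<bar> \<le> D \<zeta>" using Pf by blast
      obtain C E where CE: "summing_bound p C E" "\<And>\<xi> \<zeta>. \<bar>g (\<xi> + \<zeta>) - g \<xi>\<bar> \<le> E \<zeta>" using Pg by blast
      have "summing_bound p (B + C) (\<lambda>\<xi>. D \<xi> + E \<xi>)"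
        by (rule summing_bound_add[OF BD(1) CE(1) p])
      moreover have "\<bar>(f (\<xi> + \<zeta>) + g (\<xi> + \<zeta>)) - (f \<xi> + g \<xi>)\<bar> \<le> D \<zeta> + E \<zeta>"
        "\<bar>max (f (\<xi> + \<zeta>)) (g (\<xi> + \<zeta>)) - max (f \<xi>) (g \<xi>)\<bar> \<le> D \<zeta> + E \<zeta>"
        "\<bar>min (f (\<xi> + \<zeta>)) (g (\<xi> + \<zeta>)) - min (f \<xi>) (g \<xi>)\<bar> \<le> D \<zeta> + E \<zeta>" for \<xi> \<zeta>
        using BD(2)[of \<xi> \<zeta>] CE(2)[of \<xi> \<zeta>] by (auto simp: max_def min_def abs_le_iff)
      ultimately show ?thesis by blast
    qed
    show "vector_sublattice {f \<in> Hw. ?P f}"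
      using vector_sublattice_Hw[where 'a = 'a] 0 scale both
      unfolding vector_sublattice_def sup_real_fun inf_real_fun by (intro conjI ballI allI; simp)
  qed auto
  then show ?thesis using f by blast
qed

section \<open>Norm limits of free vector lattice elements\<close>

lemma LIMSEQ_if_abs_diff_le:
  fixes x :: "nat \<Rightarrow> real"
  assumes "\<And>n. \<bar>l - x n\<bar> \<le> e n * b" "e \<longlonglongrightarrow> 0"
  shows "x \<longlonglongrightarrow> l"
proof -
  have "(\<lambda>n. e n * b) \<longlonglongrightarrow> 0" using tendsto_mult_left_zero[OF assms(2)] .
  then have "(\<lambda>n. x n - l) \<longlonglongrightarrow> 0"
    by (rule Lim_null_comparison[rotated]) (use assms(1) in \<open>auto simp: abs_minus_commute\<close>)
  then show ?thesis by (rule LIM_zero_cancel)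
qed

text \<open>The error is uniform on bounded sets, which is where weak-star continuity is
  required.\<close>

lemma Hw_uniform_limit:
  fixes f :: "('a::real_normed_vector \<Rightarrow>\<^sub>L real) \<Rightarrow> real"
  assumes g: "\<And>n. g n \<in> Hw" and fg: "\<And>n \<xi>. \<bar>f \<xi> - g n \<xi>\<bar> \<le> e n * norm \<xi>"
    and e: "e \<longlonglongrightarrow> 0"
  shows "f \<in> Hw"
  unfolding Hw_def
proof (intro CollectI conjI allI impI)
  fix r :: real and \<xi> :: "'a \<Rightarrow>\<^sub>L real" assume r: "0 \<le> r"
  have lim: "(\<lambda>n. g n \<zeta>) \<longlonglongrightarrow> f \<zeta>" for \<zeta>
    by (rule LIMSEQ_if_abs_diff_le[OF fg e])
  have "(\<lambda>n. r * g n \<xi>) \<longlonglongrightarrow> f (r *\<^sub>R \<xi>)"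
    using lim[of "r *\<^sub>R \<xi>"] g r by (simp add: Hw_def)
  then show "f (r *\<^sub>R \<xi>) = r * f \<xi>"
    using tendsto_mult_left[OF lim, of r \<xi>] LIMSEQ_unique by blast
next
  fix B :: "('a \<Rightarrow>\<^sub>L real) set" assume "bounded B"
  then obtain R where R: "0 < R" "\<And>\<xi>. \<xi> \<in> B \<Longrightarrow> norm \<xi> \<le> R" by (auto simp: bounded_pos)
  show "continuous_map (subtopology weak_star B) euclideanreal f"
    unfolding mtopology_is_euclidean[symmetric]
  proof (rule Met_TC.continuous_map_uniform_limit)
    show "\<forall>\<^sub>F n in sequentially. continuous_map (subtopology weak_star B) Met_TC.mtopology (g n)"
      using g \<open>bounded B\<close> by (simp add: Hw_def)
    fix \<epsilon> :: real assume "0 < \<epsilon>"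
    then have "\<forall>\<^sub>F n in sequentially. e n < \<epsilon> / R"
      using e R by (intro order_tendstoD) auto
    then show "\<forall>\<^sub>F n in sequentially. \<forall>\<xi>\<in>topspace (subtopology weak_star B). f \<xi> \<in> UNIV \<and> dist (g n \<xi>) (f \<xi>) < \<epsilon>"
    proof eventually_elim
      case (elim n)
      show ?case
      proof (intro ballI conjI UNIV_I)
        fix \<xi> assume "\<xi> \<in> topspace (subtopology weak_star B)"
        then have n: "norm \<xi> \<le> R" using R by simp
        have "\<bar>f \<xi> - g n \<xi>\<bar> \<le> e n * norm \<xi>" by (rule fg)
        also have "\<dots> \<le> max 0 (e n) * R" using n by (intro mult_mono) auto
        also have "\<dots> < \<epsilon>" using elim R \<open>0 < \<epsilon>\<close> by (auto simp: max_def less_divide_eq)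
        finally show "dist (g n \<xi>) (f \<xi>) < \<epsilon>" by (simp add: dist_real_def abs_minus_commute)
      qed
    qed
  qed simp
qed

text \<open>The Lipschitz control at the base point 0, where \<open>f\<close> vanishes.\<close>

lemma FVL_summing_bound:
  assumes p: "1 \<le> p" and f: "f \<in> FVL"
  shows "\<exists>B. summing_bound p B f"
proof -
  obtain B D where BD: "summing_bound p B D" "\<And>\<xi> \<zeta>. \<bar>f (\<xi> + \<zeta>) - f \<xi>\<bar> \<le> D \<zeta>"
    using FVL_lipschitz[OF p f] by blast
  have "f 0 = 0" using f FVL_subset_Hw Hw_zero by blast
  then have "\<bar>f \<zeta>\<bar> \<le> \<bar>D \<zeta>\<bar>" for \<zeta> using BD(2)[of 0 \<zeta>] by simp
  then show ?thesis using summing_bound_mono[OF BD(1) _ order_refl p] by blast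
qed

text \<open>Here \<open>f\<close> is an arbitrary function: membership in \<open>Hw\<close> and
  finiteness of the norm are also derived from the approximations.\<close>

lemma FBL_if_limit:
  assumes p: "1 \<le> p" and g: "\<And>n. g n \<in> FVL"
    and fg: "\<And>n. summing_bound p (e n) (\<lambda>\<xi>. f \<xi> - g n \<xi>)" and e: "e \<longlonglongrightarrow> 0"
  shows "f \<in> FBL p"
proof -
  have "f \<in> Hw"
  proof (rule Hw_uniform_limit)
    show "g n \<in> Hw" for n using g FVL_subset_Hw by blast
    show "\<bar>f \<xi> - g n \<xi>\<bar> \<le> (2 * e n) * norm \<xi>" for n \<xi>
      using summing_bound_pointwise[OF fg p] by simp
    show "(\<lambda>n. 2 * e n) \<longlonglongrightarrow> 0" using tendsto_mult_right_zero[OF e] .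
  qed
  moreover have "fbl_norm p f < \<infinity>"
  proof -
    obtain B where "summing_bound p B (g 0)" using FVL_summing_bound[OF p g] by blast
    then have "summing_bound p (e 0 + B) f" using summing_bound_add[OF fg[of 0] _ p, of B "g 0"] by simp
    then show ?thesis
      using fbl_norm_le[OF _ p] by (metis ennreal_less_top infinity_ennreal_def le_less_trans)
  qed
  moreover have "\<exists>h\<in>FVL. fbl_norm p (\<lambda>\<xi>. f \<xi> - h \<xi>) < \<epsilon>" if "0 < \<epsilon>" for \<epsilon>
  proof -
    have "(\<lambda>n. ennreal (e n)) \<longlonglongrightarrow> ennreal 0" using e by (intro tendsto_ennrealI)
    then have "\<forall>\<^sub>F n in sequentially. ennreal (e n) < \<epsilon>" using that by (intro order_tendstoD) auto
    then obtain n where "ennreal (e n) < \<epsilon>" using eventually_happens[of _ sequentially] by auto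
    then show ?thesis using fbl_norm_le[OF fg p] g by (intro bexI[of _ "g n"]) (auto intro: le_less_trans)
  qed
  ultimately show ?thesis by (simp add: FBL_def Hwp_def)
qed

lemma FVL_subset_FBL:
  assumes p: "1 \<le> p"
  shows "FVL \<subseteq> FBL p"
proof
  fix f :: "('a \<Rightarrow>\<^sub>L real) \<Rightarrow> real" assume f: "f \<in> FVL"
  \<comment> \<open>The constant 0 is excluded from \<open>summing_bound\<close>, so the zero error
    receives the constants \<open>1 / Suc n\<close>.\<close>
  have z: "summing_bound p (1 / real (Suc n)) (\<lambda>_ :: 'a \<Rightarrow>\<^sub>L real. 0)" for n
    using p by (simp add: summing_bound_def)
  have "(\<lambda>n. 1 / real (Suc n)) \<longlonglongrightarrow> 0" by (rule LIMSEQ_Suc[OF lim_1_over_n])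
  then show "f \<in> FBL p"
    using z by (intro FBL_if_limit[OF p f, of "\<lambda>n. 1 / real (Suc n)"]) simp_all
qed

section \<open>Complemented Hilbertian subspaces of the dual\<close>

lemma ell_norm_2: "ell_norm 2 s a = sqrt (\<Sum>k<s. (a k)\<^sup>2)"
proof -
  have "(2::ereal) \<noteq> \<infinity>" "real_of_ereal 2 = 2" by simp_all
  then show ?thesis by (simp add: ell_norm_def powr_half_sqrt sum_nonneg)
qed

text \<open>The images of the unit vectors are scaled by \<open>L\<close>; this puts the whole
  distortion \<open>K * L\<close> into the upper estimate and leaves the constant 1 in the lower
  one.\<close>

lemma isomorphic_ell2_basis:
  fixes F :: "'z::real_normed_vector set"
  assumes iso: "isomorphic_ell2 c s F" and s: "1 \<le> s"
  obtains V :: "nat \<Rightarrow> 'z" where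
    "F = range (\<lambda>a. \<Sum>j<s. a j *\<^sub>R V j)"
    "\<And>a. sqrt (\<Sum>j<s. (a j)\<^sup>2) \<le> norm (\<Sum>j<s. a j *\<^sub>R V j)"
    "\<And>a. norm (\<Sum>j<s. a j *\<^sub>R V j) \<le> c * sqrt (\<Sum>j<s. (a j)\<^sup>2)"
proof -
  obtain u K L where bij: "bij_betw u (ell_carrier s) F"
    and add: "\<And>a b. a \<in> ell_carrier s \<Longrightarrow> b \<in> ell_carrier s \<Longrightarrow> u (\<lambda>k. a k + b k) = u a + u b"
    and scale: "\<And>r a. a \<in> ell_carrier s \<Longrightarrow> u (\<lambda>k. r * a k) = r *\<^sub>R u a"
    and K: "0 \<le> K" "\<And>a. a \<in> ell_carrier s \<Longrightarrow> norm (u a) \<le> K * ell_norm 2 s a"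
    and L: "0 \<le> L" "\<And>a. a \<in> ell_carrier s \<Longrightarrow> ell_norm 2 s a \<le> L * norm (u a)"
    and KL: "K * L \<le> c"
    using iso unfolding isomorphic_ell2_def by blast
  define e where "e j = (\<lambda>k. if k = j then 1 else 0 :: real)" for j :: nat
  have e: "e j \<in> ell_carrier s" if "j < s" for j using that by (auto simp: e_def ell_carrier_def)
  \<comment> \<open>Coefficient tuples are arbitrary beyond \<open>s\<close>; truncation brings them
    into the domain of \<open>u\<close>, and truncating at \<open>m\<close> drives the induction for
    the basis expansion.\<close>
  define cut where "cut m a = (\<lambda>k. if k < m then a k else 0 :: real)" for m and a :: "nat \<Rightarrow> real"
  have cut: "cut m a \<in> ell_carrier s" if "m \<le> s" for m a
    using that by (auto simp: cut_def ell_carrier_def)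
  have u_cut: "u (cut m a) = (\<Sum>j<m. a j *\<^sub>R u (e j))" if "m \<le> s" for m a
    using that
  proof (induction m)
    case 0
    have "u (\<lambda>k. 0 * cut 0 a k) = 0 *\<^sub>R u (cut 0 a)" by (rule scale[OF cut]) simp
    then show ?case by (simp add: cut_def)
  next
    case (Suc m)
    have "cut (Suc m) a = (\<lambda>k. cut m a k + a m * e m k)"
      by (auto simp: cut_def e_def fun_eq_iff less_Suc_eq)
    moreover have "(\<lambda>k. a m * e m k) \<in> ell_carrier s"
      using Suc.prems by (auto simp: e_def ell_carrier_def)
    ultimately have "u (cut (Suc m) a) = u (cut m a) + a m *\<^sub>R u (e m)"
      using Suc.prems by (simp add: add cut scale e)
    then show ?case using Suc by simp
  qed
  have n_cut: "ell_norm 2 s (cut s a) = sqrt (\<Sum>j<s. (a j)\<^sup>2)" for a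
    unfolding ell_norm_2 cut_def by simp
  have "1 = ell_norm 2 s (e 0)"
    unfolding ell_norm_2 e_def using s by (simp add: if_distrib[of "\<lambda>x. x\<^sup>2"] cong: if_cong)
  also have "\<dots> \<le> L * norm (u (e 0))" using s by (intro L e) auto
  finally have L0: "0 < L" using L(1) by (cases "L = 0") auto
  define V where "V j = L *\<^sub>R u (e j)" for j
  have V: "(\<Sum>j<s. a j *\<^sub>R V j) = L *\<^sub>R u (cut s a)" for a
    by (simp add: u_cut V_def scaleR_sum_right mult.commute)
  show ?thesis
  proof
    show "F = range (\<lambda>a. \<Sum>j<s. a j *\<^sub>R V j)"
    proof (intro equalityI subsetI)
      fix z assume "z \<in> F"
      then obtain a where a: "a \<in> ell_carrier s" "z = u a"
        using bij by (auto simp: bij_betw_def)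
      have eq: "cut s (\<lambda>k. a k / L) = (\<lambda>k. (1 / L) * a k)"
        using a by (auto simp: cut_def ell_carrier_def fun_eq_iff)
      have "u (cut s (\<lambda>k. a k / L)) = (1 / L) *\<^sub>R z"
        unfolding a(2) eq by (rule scale[OF a(1)])
      then have "(\<Sum>j<s. (a j / L) *\<^sub>R V j) = L *\<^sub>R ((1 / L) *\<^sub>R z)" by (simp only: V)
      also have "\<dots> = z" using L0 by simp
      finally have "(\<Sum>j<s. (a j / L) *\<^sub>R V j) = z" .
      then show "z \<in> range (\<lambda>a. \<Sum>j<s. a j *\<^sub>R V j)"
        by (intro image_eqI[of _ _ "\<lambda>j. a j / L"]) auto
    next
      fix z assume "z \<in> range (\<lambda>a. \<Sum>j<s. a j *\<^sub>R V j)"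
      then obtain a where "z = L *\<^sub>R u (cut s a)" by (auto simp: V)
      then have "z = u (\<lambda>k. L * cut s a k)" by (simp add: scale cut)
      moreover have "(\<lambda>k. L * cut s a k) \<in> ell_carrier s" by (simp add: ell_carrier_def cut_def)
      ultimately show "z \<in> F" using bij by (auto simp: bij_betw_def)
    qed
    fix a
    show "sqrt (\<Sum>j<s. (a j)\<^sup>2) \<le> norm (\<Sum>j<s. a j *\<^sub>R V j)"
      using L(2)[OF cut[OF order_refl], of a, unfolded n_cut] L0 by (simp add: V)
    have "L * norm (u (cut s a)) \<le> L * (K * sqrt (\<Sum>j<s. (a j)\<^sup>2))"
      using K(2)[OF cut[OF order_refl], of a, unfolded n_cut] L0 by (intro mult_left_mono) auto
    also have "\<dots> \<le> c * sqrt (\<Sum>j<s. (a j)\<^sup>2)"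
      using mult_right_mono[OF KL, of "sqrt (\<Sum>j<s. (a j)\<^sup>2)"] by (simp add: mult_ac sum_nonneg)
    finally show "norm (\<Sum>j<s. a j *\<^sub>R V j) \<le> c * sqrt (\<Sum>j<s. (a j)\<^sup>2)"
      using L0 by (simp add: V)
  qed
qed

text \<open>If every vector annihilated by the other \<open>V j\<close> were annihilated by
  \<open>V k\<close>, then \<open>V k\<close> would be a combination of them, contradicting the
  lower estimate. So the dual vectors exist in the space itself.\<close>

lemma ex_biorthogonal:
  fixes V :: "nat \<Rightarrow> ('a::real_normed_vector \<Rightarrow>\<^sub>L real)"
  assumes low: "\<And>a. sqrt (\<Sum>j<s. (a j)\<^sup>2) \<le> norm (\<Sum>j<s. a j *\<^sub>R V j)"
  obtains w where "\<And>j k. j < s \<Longrightarrow> k < s \<Longrightarrow> blinfun_apply (V j) (w k) = (if j = k then 1 else 0)"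
proof -
  have "\<exists>w. \<forall>j<s. blinfun_apply (V j) w = (if j = k then 1 else 0)" if k: "k < s" for k
  proof -
    have "\<exists>w. (\<forall>j\<in>{..<s} - {k}. blinfun_apply (V j) w = 0) \<and> blinfun_apply (V k) w \<noteq> 0"
    proof (rule ccontr)
      assume "\<not> ?thesis"
      then have "\<exists>b. \<forall>x. blinfun_apply (V k) x = (\<Sum>j\<in>{..<s} - {k}. b j * blinfun_apply (V j) x)"
        by (intro linear_combination_if_kernels_subset)
          (auto intro!: bounded_linear.linear blinfun.bounded_linear_right)
      then obtain b where b: "\<And>x. blinfun_apply (V k) x = (\<Sum>j\<in>{..<s} - {k}. b j * blinfun_apply (V j) x)"
        by blast
      define a where "a j = (if j = k then - 1 else b j)" for j
      have "(\<Sum>j<s. a j *\<^sub>R V j) = - V k + (\<Sum>j\<in>{..<s} - {k}. b j *\<^sub>R V j)"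
        using k by (simp add: sum.remove[of "{..<s}" k] a_def)
      also have "\<dots> = 0"
        by (rule blinfun_eqI) (simp add: blinfun.add_left blinfun.minus_left blinfun.diff_left blinfun.sum_left
            blinfun.scaleR_left b)
      finally have "(\<Sum>j<s. (a j)\<^sup>2) \<le> 0" using low[of a] by simp
      moreover have "(a k)\<^sup>2 \<le> (\<Sum>j<s. (a j)\<^sup>2)" using k by (intro member_le_sum) auto
      ultimately show False by (simp add: a_def)
    qed
    then obtain w where w: "\<And>j. j < s \<Longrightarrow> j \<noteq> k \<Longrightarrow> blinfun_apply (V j) w = 0" "blinfun_apply (V k) w \<noteq> 0"
      by blast
    show ?thesis
      using w by (intro exI[of _ "(1 / blinfun_apply (V k) w) *\<^sub>R w"]) (simp add: blinfun.scaleR_right)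
  qed
  then obtain w where "\<And>k. k < s \<Longrightarrow> \<forall>j<s. blinfun_apply (V j) (w k) = (if j = k then 1 else 0)"
    by metis
  then show ?thesis by (intro that[of w]) blast
qed

text \<open>Testing \<open>Q \<xi>\<close> on the biorthogonal vectors reads off its coordinates;
  weak-star continuity of \<open>Q\<close> turns these functionals into evaluations at vectors of
  the space.\<close>

lemma ex_coordinates:
  fixes V :: "nat \<Rightarrow> ('a::real_normed_vector \<Rightarrow>\<^sub>L real)"
    and Q :: "('a \<Rightarrow>\<^sub>L real) \<Rightarrow>\<^sub>L ('a \<Rightarrow>\<^sub>L real)"
  assumes low: "\<And>a. sqrt (\<Sum>j<s. (a j)\<^sup>2) \<le> norm (\<Sum>j<s. a j *\<^sub>R V j)"
    and range: "range (blinfun_apply Q) \<subseteq> range (\<lambda>a. \<Sum>j<s. a j *\<^sub>R V j)"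
    and cont: "continuous_map weak_star weak_star (blinfun_apply Q)"
  obtains v where "\<And>\<xi>. Q \<xi> = (\<Sum>j<s. blinfun_apply \<xi> (v j) *\<^sub>R V j)"
proof -
  obtain w where w: "\<And>j k. j < s \<Longrightarrow> k < s \<Longrightarrow> blinfun_apply (V j) (w k) = (if j = k then 1 else 0)"
    using ex_biorthogonal[of s V] low by blast
  have "\<exists>v. \<forall>\<xi>. blinfun_apply (Q \<xi>) (w k) = blinfun_apply \<xi> v" for k
  proof (rule weak_star_functional_is_evaluation)
    show "linear (\<lambda>\<xi>. blinfun_apply (Q \<xi>) (w k))"
      by (rule linearI) (simp_all add: blinfun.add_right blinfun.add_left blinfun.scaleR_right blinfun.scaleR_left)
    show "continuous_map weak_star euclideanreal (\<lambda>\<xi>. blinfun_apply (Q \<xi>) (w k))"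
      using continuous_map_compose[OF cont strong_operator_topology_continuous_evaluation[of "w k"]]
      by (simp add: o_def)
  qed
  then obtain v where v: "\<And>k \<xi>. blinfun_apply (Q \<xi>) (w k) = blinfun_apply \<xi> (v k)" by metis
  have "Q \<xi> = (\<Sum>j<s. blinfun_apply \<xi> (v j) *\<^sub>R V j)" for \<xi>
  proof -
    obtain a where a: "Q \<xi> = (\<Sum>j<s. a j *\<^sub>R V j)" using range by auto
    have "blinfun_apply \<xi> (v k) = a k" if "k < s" for k
    proof -
      have "blinfun_apply \<xi> (v k) = (\<Sum>j<s. a j * blinfun_apply (V j) (w k))"
        by (simp add: a blinfun.sum_left blinfun.scaleR_left flip: v)
      also have "\<dots> = (\<Sum>j<s. if j = k then a j else 0)"
        using that by (intro sum.cong) (auto simp: w)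
      finally show ?thesis using that by simp
    qed
    then show ?thesis by (simp add: a)
  qed
  then show ?thesis by (rule that)
qed

text \<open>\<open>h\<close> is the mean of the absolute coordinates, so Cauchy-Schwarz gives its
  upper bound. The \<open>z k\<close> have all coordinates 1 or -1; a shift by
  \<open>\<theta> *\<^sub>R z k\<close> changes each coordinate by exactly \<open>\<theta>\<close>
  in absolute value, and the triangle inequality gives the last estimate.\<close>

lemma ex_lattice_witness:
  fixes Q :: "('a::real_normed_vector \<Rightarrow>\<^sub>L real) \<Rightarrow>\<^sub>L ('a \<Rightarrow>\<^sub>L real)"
  assumes p: "1 \<le> p" and c: "0 \<le> c" and s: "1 \<le> s"
    and iso: "isomorphic_ell2 c s F" and idem: "Q o\<^sub>L Q = Q" and range: "range (blinfun_apply Q) = F"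
    and cont: "continuous_map weak_star weak_star (blinfun_apply Q)"
  obtains h z where "h \<in> FVL" "\<And>\<xi>. 0 \<le> h \<xi>" "\<And>\<xi>. h \<xi> \<le> real s powr (- 1 / 2) * norm (Q \<xi>)"
    "weak_norm p (2 ^ s) z \<le> c * (1 + khintchine_const p) * real (2 ^ s) powr (1 / p)"
    "\<And>k \<theta> \<xi>. 0 \<le> \<theta> \<Longrightarrow> \<theta> - h \<xi> \<le> h (\<xi> + \<theta> *\<^sub>R z k)"
proof -
  obtain V where F: "F = Set.range (\<lambda>a. \<Sum>j<s. a j *\<^sub>R V j)"
    and low: "\<And>a. sqrt (\<Sum>j<s. (a j)\<^sup>2) \<le> norm (\<Sum>j<s. a j *\<^sub>R V j)"
    and up: "\<And>a. norm (\<Sum>j<s. a j *\<^sub>R V j) \<le> c * sqrt (\<Sum>j<s. (a j)\<^sup>2)"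
    by (rule isomorphic_ell2_basis[OF iso s]) (rule that)
  obtain v where v: "\<And>\<xi>. Q \<xi> = (\<Sum>j<s. blinfun_apply \<xi> (v j) *\<^sub>R V j)"
    using ex_coordinates[OF low _ cont] range F by blast
  define h where "h \<xi> = 1 / real s * (\<Sum>j<s. \<bar>delta (v j) \<xi>\<bar>)" for \<xi>
  define z where "z k = (\<Sum>j<s. sign_bit j k *\<^sub>R V j)" for k
  \<comment> \<open>\<open>Q\<close> fixes \<open>z k\<close>, and the lower estimate makes
    coordinates unique.\<close>
  have z: "blinfun_apply (z k) (v j) = sign_bit j k" if "j < s" for j k
  proof -
    have "z k \<in> Set.range (blinfun_apply Q)" unfolding range F z_def
      by (rule image_eqI[of _ _ "\<lambda>j. sign_bit j k"]) auto
    then obtain \<xi> where "z k = Q \<xi>" by blast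
    then have "Q (z k) = z k" using arg_cong[OF idem, of "\<lambda>T. blinfun_apply T \<xi>"] by simp
    then have "(\<Sum>i<s. (blinfun_apply (z k) (v i) - sign_bit i k) *\<^sub>R V i) = 0"
      by (simp add: scaleR_diff_left sum_subtractf z_def[symmetric] v[symmetric])
    then have "(\<Sum>i<s. (blinfun_apply (z k) (v i) - sign_bit i k)\<^sup>2) \<le> 0"
      using low[of "\<lambda>i. blinfun_apply (z k) (v i) - sign_bit i k"] by simp
    moreover have "(blinfun_apply (z k) (v j) - sign_bit j k)\<^sup>2
      \<le> (\<Sum>i<s. (blinfun_apply (z k) (v i) - sign_bit i k)\<^sup>2)"
      using that by (intro member_le_sum) auto
    ultimately have "(blinfun_apply (z k) (v j) - sign_bit j k)\<^sup>2 \<le> 0" by linarith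
    then show ?thesis by simp
  qed
  show ?thesis
  proof
    show "h \<in> FVL" unfolding h_def[abs_def] by (intro FVL_scale FVL_sum FVL_abs delta_in_FVL)
    show "0 \<le> h \<xi>" for \<xi> by (simp add: h_def sum_nonneg)
    show "h \<xi> \<le> real s powr (- 1 / 2) * norm (Q \<xi>)" for \<xi>
    proof -
      have "(\<Sum>j<s. \<bar>delta (v j) \<xi>\<bar> * \<bar>1\<bar>) \<le> L2_set (\<lambda>j. delta (v j) \<xi>) {..<s} * L2_set (\<lambda>_. 1) {..<s}"
        by (rule L2_set_mult_ineq)
      then have "(\<Sum>j<s. \<bar>delta (v j) \<xi>\<bar>) \<le> sqrt (\<Sum>j<s. (blinfun_apply \<xi> (v j))\<^sup>2) * sqrt (real s)"
        by (simp add: L2_set_def delta_def)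
      also have "\<dots> \<le> norm (Q \<xi>) * sqrt (real s)"
        unfolding v by (intro mult_right_mono low) auto
      finally have "h \<xi> \<le> 1 / real s * (norm (Q \<xi>) * sqrt (real s))"
        unfolding h_def by (rule mult_left_mono) simp
      also have "\<dots> = real s powr (- 1 / 2) * norm (Q \<xi>)"
        using s by (simp add: powr_minus powr_half_sqrt field_simps)
      finally show ?thesis .
    qed
    show "weak_norm p (2 ^ s) z \<le> c * (1 + khintchine_const p) * real (2 ^ s) powr (1 / p)"
      unfolding z_def[abs_def] by (rule weak_norm_signs[OF p c up])
    show "\<theta> - h \<xi> \<le> h (\<xi> + \<theta> *\<^sub>R z k)" if "0 \<le> \<theta>" for k \<theta> \<xi>
    proof -
      have "(\<Sum>j<s. \<theta> - \<bar>delta (v j) \<xi>\<bar>) \<le> (\<Sum>j<s. \<bar>delta (v j) (\<xi> + \<theta> *\<^sub>R z k)\<bar>)"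
      proof (intro sum_mono)
        fix j assume "j \<in> {..<s}"
        then have "delta (v j) (\<xi> + \<theta> *\<^sub>R z k) = delta (v j) \<xi> + \<theta> * sign_bit j k"
          by (simp add: delta_def blinfun.add_left blinfun.scaleR_left z)
        moreover have "\<bar>\<theta> * sign_bit j k\<bar> = \<theta>" using that by (simp add: abs_mult)
        ultimately show "\<theta> - \<bar>delta (v j) \<xi>\<bar> \<le> \<bar>delta (v j) (\<xi> + \<theta> *\<^sub>R z k)\<bar>" by linarith
      qed
      then have "1 / real s * (\<Sum>j<s. \<theta> - \<bar>delta (v j) \<xi>\<bar>) \<le> h (\<xi> + \<theta> *\<^sub>R z k)"
        unfolding h_def by (rule mult_left_mono) simp
      moreover have "1 / real s * (\<Sum>j<s. \<theta> - \<bar>delta (v j) \<xi>\<bar>) = \<theta> - h \<xi>"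
        unfolding h_def using s by (simp add: sum_subtractf right_diff_distrib)
      ultimately show ?thesis by simp
    qed
  qed
qed

section \<open>Failure of regularity\<close>

lemma ex_summing_bound_le:
  assumes p: "1 \<le> p" and e: "0 < e"
    and lim: "((\<lambda>s. ennreal (real s powr (- 1 / 2)) * summing_norm p (T s)) \<longlongrightarrow> 0) sequentially"
  shows "\<exists>s\<ge>1. real s powr (- 1 / 2) \<le> e \<and> summing_bound p e (\<lambda>y. real s powr (- 1 / 2) * norm (T s y))"
proof -
  have "\<forall>\<^sub>F s in sequentially. ennreal (real s powr (- 1 / 2)) * summing_norm p (T s) < ennreal e"
    using lim e by (intro order_tendstoD) auto
  moreover have "((\<lambda>s. real s powr (- 1 / 2)) \<longlongrightarrow> 0) sequentially"
    by (rule tendsto_neg_powr) (auto simp: filterlim_real_sequentially)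
  then have "\<forall>\<^sub>F s in sequentially. real s powr (- 1 / 2) < e"
    using e by (rule order_tendstoD)
  ultimately have "\<forall>\<^sub>F s in sequentially. 1 \<le> s \<and> real s powr (- 1 / 2) < e
      \<and> ennreal (real s powr (- 1 / 2)) * summing_norm p (T s) < ennreal e"
    using eventually_ge_at_top[of 1] by eventually_elim simp
  then obtain s where s: "1 \<le> s" "real s powr (- 1 / 2) < e"
    "ennreal (real s powr (- 1 / 2)) * summing_norm p (T s) < ennreal e"
    by (auto simp: eventually_sequentially)
  define a where "a = real s powr (- 1 / 2)"
  have a: "0 < a" using s by (simp add: a_def)
  have "summing_norm p (T s) < ennreal (e / a)"
  proof (rule ccontr)
    assume "\<not> ?thesis"
    then have "ennreal a * ennreal (e / a) \<le> ennreal a * summing_norm p (T s)"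
      by (intro mult_left_mono) auto
    moreover have "ennreal a * ennreal (e / a) = ennreal e"
      using a e by (simp flip: ennreal_mult)
    ultimately show False using s(3) unfolding a_def[symmetric] by (simp add: not_le[symmetric])
  qed
  then have "summing_bound p (e / a) (\<lambda>y. norm (T s y))"
    by (rule summing_bound_if_summing_norm_less[OF _ p])
  then have "summing_bound p e (\<lambda>y. a * norm (T s y))"
    by (rule summing_bound_scale) (use a e p in auto)
  then show ?thesis using s by (auto simp: a_def)
qed

text \<open>An upper bound of \<open>{- (\<bar>\<delta>\<^sub>x\<bar> - \<Sum>\<^sub>k\<^sub><\<^sub>n 2\<^sup>k h\<^sub>k)\<^sup>+}\<close> that is negative at \<open>\<xi>\<close>
  stays negative at \<open>\<xi> + \<theta> z\<close> for some vector \<open>z\<close> of the sign tuple, because it is close in norm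
  to a Lipschitz function; but there \<open>2\<^sup>k h\<^sub>k\<close> exceeds \<open>\<bar>\<delta>\<^sub>x\<bar>\<close> when \<open>k\<close> is large.\<close>

lemma upper_bound_nonneg:
  fixes h :: "nat \<Rightarrow> ('a::real_normed_vector \<Rightarrow>\<^sub>L real) \<Rightarrow> real"
  assumes p: "1 \<le> p" and R: "0 < R"
    and h_nonneg: "\<And>k \<xi>. 0 \<le> h k \<xi>"
    and h_le: "\<And>k \<xi>. h k \<xi> \<le> (1 / 4) ^ k * (b * norm \<xi>)"
    and N: "\<And>k. 0 < N k"
    and z: "\<And>k. weak_norm p (N k) (z k) \<le> R * real (N k) powr (1 / p)"
    and shift: "\<And>k j \<theta> \<xi>. 0 \<le> \<theta> \<Longrightarrow> \<theta> - h k \<xi> \<le> h k (\<xi> + \<theta> *\<^sub>R z k j)"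
    and v: "v \<in> FBL p"
    and upper: "\<And>n \<xi>. - max 0 (\<bar>delta x \<xi>\<bar> - (\<Sum>k<n. 2 ^ k * h k \<xi>)) \<le> v \<xi>"
  shows "0 \<le> v \<xi>"
proof (rule ccontr)
  assume neg: "\<not> 0 \<le> v \<xi>"
  \<comment> \<open>Three errors of at most \<open>\<eta>\<close> must fit into
    \<open>- v \<xi> = 4 * \<eta>\<close>: the approximation of \<open>v\<close> by \<open>g\<close>
    at the old and at the new point, and the variation of \<open>g\<close>.\<close>
  define \<eta> where "\<eta> = - v \<xi> / 4"
  have \<eta>: "0 < \<eta>" using neg by (simp add: \<eta>_def)
  \<comment> \<open>For \<open>\<theta> \<le> 1\<close> this bounds the weak norm of the translated
    tuple relative to \<open>N k powr (1 / p)\<close>.\<close>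
  define R' where "R' = 2 * norm \<xi> + R"
  have R': "0 < R'" using R by (simp add: R'_def add_nonneg_pos)
  define d where "d = \<eta> / (4 * R')"
  have d: "0 < d" "d * R' = \<eta> / 4" using \<eta> R' by (auto simp: d_def)
  obtain g where g: "g \<in> FVL" and "fbl_norm p (\<lambda>\<xi>. v \<xi> - g \<xi>) < ennreal d"
    using v d unfolding FBL_def by (auto dest: spec[of _ "ennreal d"])
  then have vg: "summing_bound p d (\<lambda>\<xi>. v \<xi> - g \<xi>)"
    by (intro summing_bound_if_fbl_norm_less p)
  obtain B D where BD: "summing_bound p B D" and D: "\<And>\<xi> \<zeta>. \<bar>g (\<xi> + \<zeta>) - g \<xi>\<bar> \<le> D \<zeta>"
    using FVL_lipschitz[OF p g] by blast
  have D0: "0 \<le> D \<zeta>" for \<zeta> using D[of 0 \<zeta>] by linarith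
  \<comment> \<open>With the extra term, the single bound \<open>D' \<zeta> < \<eta>\<close> yields
    both \<open>D \<zeta> < \<eta>\<close> and
    \<open>\<bar>delta x \<zeta>\<bar> < 1\<close>.\<close>
  define D' where "D' \<zeta> = D \<zeta> + \<eta> * \<bar>delta x \<zeta>\<bar>" for \<zeta>
  define B' where "B' = B + \<eta> * (norm x + 1)"
  have D': "summing_bound p B' D'"
    unfolding D'_def[abs_def] B'_def
  proof (rule summing_bound_add[OF BD _ p])
    have "summing_bound p (norm x + 1) (\<lambda>\<xi>. \<bar>delta x \<xi>\<bar>)"
      by (rule summing_bound_mono[OF summing_bound_delta[OF p]]) (auto simp: p)
    then show "summing_bound p (\<eta> * (norm x + 1)) (\<lambda>\<xi>. \<eta> * \<bar>delta x \<xi>\<bar>)"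
      by (rule summing_bound_scale) (use \<eta> p in \<open>auto simp: add_nonneg_pos\<close>)
  qed
  have B': "0 < B'" using D' by (simp add: summing_bound_def)
  \<comment> \<open>The step size does not depend on \<open>k\<close>, so \<open>k\<close> may be
    chosen afterwards.\<close>
  define \<theta> where "\<theta> = min 1 (\<eta> / (2 * B' * R))"
  have \<theta>: "0 < \<theta>" "\<theta> \<le> 1" "B' * (\<theta> * R) \<le> \<eta> / 2"
  proof -
    show "0 < \<theta>" "\<theta> \<le> 1" using \<eta> B' R by (auto simp: \<theta>_def)
    have "\<theta> * (B' * R) \<le> \<eta> / (2 * B' * R) * (B' * R)"
      using B' R by (intro mult_right_mono) (auto simp: \<theta>_def)
    then show "B' * (\<theta> * R) \<le> \<eta> / 2" using B' R by (simp add: mult_ac)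
  qed
  \<comment> \<open>At the new point \<open>2 ^ k * \<theta>\<close> has to beat
    \<open>\<bar>delta x \<xi>\<bar>\<close>, its change by less than 1, and the loss caused by
    \<open>h k \<xi>\<close>, for which the decay \<open>(1 / 4) ^ k\<close> absorbs the weight
    \<open>2 ^ k\<close>.\<close>
  obtain k :: nat where k: "(\<bar>delta x \<xi>\<bar> + 1 + \<bar>b\<bar> * norm \<xi>) / \<theta> < 2 ^ k"
    using real_arch_pow[of 2] by auto
  have small: "\<exists>j<N k. \<bar>D' (\<theta> *\<^sub>R z k j)\<bar> < \<eta> \<and> \<bar>v (\<xi> + \<theta> *\<^sub>R z k j) - g (\<xi> + \<theta> *\<^sub>R z k j)\<bar> < \<eta>"
  proof (rule summing_bound_small_simultaneously[OF p N \<eta> D' vg])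
    have zk: "\<theta> * weak_norm p (N k) (z k) \<le> \<theta> * (R * real (N k) powr (1 / p))"
      using \<theta> z by (intro mult_left_mono) auto
    have "weak_norm p (N k) (\<lambda>j. 0 + \<theta> *\<^sub>R z k j) \<le> 2 * real (N k) powr (1 / p) * norm (0 :: 'a \<Rightarrow>\<^sub>L real) + \<bar>\<theta>\<bar> * weak_norm p (N k) (z k)"
      by (rule weak_norm_translate[OF p N])
    then show "weak_norm p (N k) (\<lambda>j. \<theta> *\<^sub>R z k j) \<le> (\<theta> * R) * real (N k) powr (1 / p)"
      using order_trans[OF _ zk] \<theta> by (simp add: mult.assoc)
    have "weak_norm p (N k) (\<lambda>j. \<xi> + \<theta> *\<^sub>R z k j)
        \<le> 2 * real (N k) powr (1 / p) * norm \<xi> + \<bar>\<theta>\<bar> * weak_norm p (N k) (z k)"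
      by (rule weak_norm_translate[OF p N])
    also have "\<dots> \<le> 2 * real (N k) powr (1 / p) * norm \<xi> + 1 * (R * real (N k) powr (1 / p))"
      using \<theta> z[of k] R by (intro add_left_mono mult_mono) (auto simp: weak_norm_nonneg p)
    also have "\<dots> = R' * real (N k) powr (1 / p)" by (simp add: R'_def algebra_simps)
    finally show "weak_norm p (N k) (\<lambda>j. \<xi> + \<theta> *\<^sub>R z k j) \<le> R' * real (N k) powr (1 / p)" .
    show "d * R' < \<eta> / 2" using d \<eta> by simp
  qed (rule \<theta>)
  obtain j where j: "\<bar>D' (\<theta> *\<^sub>R z k j)\<bar> < \<eta>"
    "\<bar>v (\<xi> + \<theta> *\<^sub>R z k j) - g (\<xi> + \<theta> *\<^sub>R z k j)\<bar> < \<eta>" using small by blast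
  define \<zeta> where "\<zeta> = \<theta> *\<^sub>R z k j"
  have "D \<zeta> < \<eta>" and dx: "\<bar>delta x \<zeta>\<bar> < 1"
  proof -
    have *: "D \<zeta> + \<eta> * \<bar>delta x \<zeta>\<bar> < \<eta>" using j(1) by (simp add: D'_def \<zeta>_def)
    have "0 \<le> \<eta> * \<bar>delta x \<zeta>\<bar>" using \<eta> by simp
    with * show "D \<zeta> < \<eta>" by linarith
    have "\<eta> * \<bar>delta x \<zeta>\<bar> < \<eta> * 1" using * D0[of \<zeta>] by linarith
    then show "\<bar>delta x \<zeta>\<bar> < 1" using \<eta> by simp
  qed
  moreover have "\<bar>v \<xi> - g \<xi>\<bar> \<le> \<eta>"
  proof -
    have "\<bar>v \<xi> - g \<xi>\<bar> \<le> 2 * d * norm \<xi>" by (rule summing_bound_pointwise[OF vg p])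
    also have "\<dots> \<le> d * R'" using d R by (simp add: R'_def algebra_simps)
    finally show ?thesis using d \<eta> by simp
  qed
  ultimately have "v (\<xi> + \<zeta>) < 0"
    using j(2) D[of \<xi> \<zeta>] unfolding \<zeta>_def[symmetric] by (simp add: \<eta>_def abs_le_iff abs_less_iff)
  \<comment> \<open>A negative value of \<open>v\<close> forces the positive part to be nonzero;
    \<open>Suc k\<close> brings the term with index \<open>k\<close> into the sum.\<close>
  then have "(\<Sum>m<Suc k. 2 ^ m * h m (\<xi> + \<zeta>)) < \<bar>delta x (\<xi> + \<zeta>)\<bar>"
    using upper[of "\<xi> + \<zeta>" "Suc k"] by linarith
  moreover have "2 ^ k * h k (\<xi> + \<zeta>) \<le> (\<Sum>m<Suc k. 2 ^ m * h m (\<xi> + \<zeta>))"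
    by (rule member_le_sum) (auto simp: h_nonneg)
  moreover have "2 ^ k * \<theta> - \<bar>b\<bar> * norm \<xi> \<le> 2 ^ k * h k (\<xi> + \<zeta>)"
  proof -
    have "2 ^ k * h k \<xi> \<le> 2 ^ k * ((1 / 4) ^ k * (b * norm \<xi>))"
      by (intro mult_left_mono h_le) auto
    also have "\<dots> = (1 / 2) ^ k * (b * norm \<xi>)"
      by (simp add: power_mult_distrib[symmetric] mult.assoc[symmetric])
    also have "\<dots> \<le> (1 / 2) ^ k * (\<bar>b\<bar> * norm \<xi>)"
      by (intro mult_left_mono mult_right_mono) auto
    also have "\<dots> \<le> 1 * (\<bar>b\<bar> * norm \<xi>)"
      by (intro mult_right_mono) (auto simp: power_le_one)
    finally have "2 ^ k * (\<theta> - h k \<xi>) \<ge> 2 ^ k * \<theta> - \<bar>b\<bar> * norm \<xi>" by (simp add: right_diff_distrib)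
    moreover have "2 ^ k * (\<theta> - h k \<xi>) \<le> 2 ^ k * h k (\<xi> + \<zeta>)"
      unfolding \<zeta>_def using \<theta> by (intro mult_left_mono shift) auto
    ultimately show ?thesis by linarith
  qed
  moreover have "\<bar>delta x (\<xi> + \<zeta>)\<bar> \<le> \<bar>delta x \<xi>\<bar> + \<bar>delta x \<zeta>\<bar>"
    by (simp add: delta_def blinfun.add_left abs_triangle_ineq)
  moreover have "\<bar>delta x \<xi>\<bar> + 1 + \<bar>b\<bar> * norm \<xi> < 2 ^ k * \<theta>"
    using k \<theta> by (simp add: divide_less_eq)
  ultimately show False using dx by linarith
qed

text \<open>Finite blocks of the tail starting at \<open>n\<close> have constants summing
  geometrically to less than \<open>(1 / 2) ^ n\<close>, and this bound survives the pointwise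
  limit.\<close>

lemma summing_bound_tail:
  assumes p: "1 \<le> p" and g: "\<And>k. summing_bound p ((1 / 2) ^ Suc k) (g k)"
  shows summable_if_summing_bound: "summable (\<lambda>k. g k y)"
    and "summing_bound p ((1 / 2) ^ n) (\<lambda>y. (\<Sum>k. g k y) - (\<Sum>k<n. g k y))"
proof -
  show sm: "summable (\<lambda>k. g k y)" for y
  proof (rule summable_comparison_test')
    show "summable (\<lambda>k. (1 / 2) ^ k * norm y)"
      by (intro summable_mult2 summable_geometric) simp
    show "norm (g k y) \<le> (1 / 2) ^ k * norm y" for k
      using summing_bound_pointwise[OF g p, of k y] by simp
  qed
  show "summing_bound p ((1 / 2) ^ n) (\<lambda>y. (\<Sum>k. g k y) - (\<Sum>k<n. g k y))"
  proof (rule summing_bound_limit[OF _ _ p])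
    have geo: "(\<Sum>k<m. (1 / 2 :: real) ^ Suc (k + n)) = (1 / 2) ^ n - (1 / 2) ^ (m + n)" for m
      by (induction m) (simp_all add: power_add field_simps)
    show "summing_bound p ((1 / 2) ^ n) (\<lambda>y. \<Sum>k<Suc m. g (k + n) y)" for m
      by (rule summing_bound_mono[OF summing_bound_sum[of p "\<lambda>k. (1 / 2) ^ Suc (k + n)" "\<lambda>k. g (k + n)" m, OF g p]])
        (simp_all only: geo p, simp_all)
    fix y
    have "(\<lambda>k. g (k + n) y) sums ((\<Sum>k. g k y) - (\<Sum>k<n. g k y))"
      using sums_iff_shift'[of "\<lambda>k. g k y" n "\<Sum>k. g k y"] summable_sums[OF sm] by blast
    then show "(\<lambda>m. \<Sum>k<Suc m. g (k + n) y) \<longlonglongrightarrow> (\<Sum>k. g k y) - (\<Sum>k<n. g k y)"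
      unfolding sums_def by (rule LIMSEQ_Suc)
  qed
qed

theorem theorem10p3:
  fixes p c :: real
    and i :: "'a::banach \<Rightarrow>\<^sub>L 'b::banach"
    and F :: "nat \<Rightarrow> ('a \<Rightarrow>\<^sub>L real) set"
    and Q :: "nat \<Rightarrow> ('a \<Rightarrow>\<^sub>L real) \<Rightarrow>\<^sub>L ('a \<Rightarrow>\<^sub>L real)"
  assumes "1 \<le> p"
    and "\<And>x. norm (i x) = norm x"
    and "c > 0"
    and "\<And>s. s \<ge> 1 \<Longrightarrow> subspace (F s)"
    and "\<And>s. s \<ge> 1 \<Longrightarrow> isomorphic_ell2 c s (F s)"
    and "\<And>s. s \<ge> 1 \<Longrightarrow> Q s o\<^sub>L Q s = Q s"
    and "\<And>s. s \<ge> 1 \<Longrightarrow> range (blinfun_apply (Q s)) = F s"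
    and "\<And>s. s \<ge> 1 \<Longrightarrow> continuous_map weak_star weak_star (blinfun_apply (Q s))"
    and "\<And>s. s \<ge> 1 \<Longrightarrow> norm (Q s) \<le> c"
    and "((\<lambda>s. ennreal (real s powr (- 1 / 2)) * summing_norm p (\<lambda>y. Q s (adj i y))) \<longlongrightarrow> 0) sequentially"
  shows "\<not> regular_image (bar i) (FBL p :: (('a \<Rightarrow>\<^sub>L real) \<Rightarrow> real) set)
    (FBL p :: (('b \<Rightarrow>\<^sub>L real) \<Rightarrow> real) set)"
proof -
  note p = assms(1)
  define R where "R = c * (1 + khintchine_const p)"
  have R: "0 < R"
    using assms(3) by (simp add: R_def khintchine_const_def add_pos_nonneg)
  \<comment> \<open>The rate \<open>(1 / 4) ^ Suc k\<close> leaves room for the weight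
    \<open>2 ^ k\<close>: the weighted terms still have constants at most
    \<open>(1 / 2) ^ Suc k\<close>.\<close>
  have "\<exists>s h z. 1 \<le> s \<and> real s powr (- 1 / 2) \<le> (1 / 4) ^ Suc k
      \<and> summing_bound p ((1 / 4) ^ Suc k) (\<lambda>y. real s powr (- 1 / 2) * norm (Q s (adj i y)))
      \<and> h \<in> FVL \<and> (\<forall>\<xi>. 0 \<le> h \<xi>) \<and> (\<forall>\<xi>. h \<xi> \<le> real s powr (- 1 / 2) * norm (Q s \<xi>))
      \<and> weak_norm p (2 ^ s) z \<le> R * real (2 ^ s) powr (1 / p)
      \<and> (\<forall>j \<theta> \<xi>. 0 \<le> \<theta> \<longrightarrow> \<theta> - h \<xi> \<le> h (\<xi> + \<theta> *\<^sub>R z j))" for k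
  proof -
    obtain s where s: "1 \<le> s" "real s powr (- 1 / 2) \<le> (1 / 4) ^ Suc k"
      "summing_bound p ((1 / 4) ^ Suc k) (\<lambda>y. real s powr (- 1 / 2) * norm (Q s (adj i y)))"
      using ex_summing_bound_le[OF p _ assms(10), of "(1 / 4) ^ Suc k"] by auto
    obtain h z where "h \<in> FVL" "\<And>\<xi>. 0 \<le> h \<xi>" "\<And>\<xi>. h \<xi> \<le> real s powr (- 1 / 2) * norm (Q s \<xi>)"
      "weak_norm p (2 ^ s) z \<le> R * real (2 ^ s) powr (1 / p)"
      "\<And>j \<theta> \<xi>. 0 \<le> \<theta> \<Longrightarrow> \<theta> - h \<xi> \<le> h (\<xi> + \<theta> *\<^sub>R z j)"
      by (rule ex_lattice_witness[OF p less_imp_le[OF assms(3)] s(1) assms(5)[OF s(1)]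
            assms(6)[OF s(1)] assms(7)[OF s(1)] assms(8)[OF s(1)], folded R_def]) (rule that)
    with s show ?thesis by blast
  qed
  then obtain s h z where s: "\<And>k. 1 \<le> s k" "\<And>k. real (s k) powr (- 1 / 2) \<le> (1 / 4) ^ Suc k"
    and sb: "\<And>k. summing_bound p ((1 / 4) ^ Suc k)
      (\<lambda>y. real (s k) powr (- 1 / 2) * norm (Q (s k) (adj i y)))"
    and h: "\<And>k. h k \<in> FVL" "\<And>k \<xi>. 0 \<le> h k \<xi>"
      "\<And>k \<xi>. h k \<xi> \<le> real (s k) powr (- 1 / 2) * norm (Q (s k) \<xi>)"
    and z: "\<And>k. weak_norm p (2 ^ s k) (z k) \<le> R * real (2 ^ s k) powr (1 / p)"
    and shift: "\<And>k j \<theta> \<xi>. 0 \<le> \<theta> \<Longrightarrow> \<theta> - h k \<xi> \<le> h k (\<xi> + \<theta> *\<^sub>R z k j)"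
    by metis
  define g where "g k y = 2 ^ k * h k (adj i y)" for k y
  have g: "summing_bound p ((1 / 2) ^ Suc k) (g k)" for k
  proof -
    have "summing_bound p ((1 / 4) ^ Suc k) (\<lambda>y. h k (adj i y))"
      by (rule summing_bound_mono[OF sb[of k] _ order_refl p]) (use h in \<open>simp add: abs_mult\<close>)
    then show ?thesis unfolding g_def[abs_def]
      by (rule summing_bound_scale) (auto simp: p power_mult_distrib[symmetric] mult.assoc[symmetric])
  qed
  have g_nonneg: "0 \<le> g k y" for k y by (simp add: g_def h)
  note summable_g = summable_if_summing_bound[OF p g]
  define G where "G y = (\<Sum>k. g k y)" for y
  have G_ge: "(\<Sum>k<n. g k y) \<le> G y" for n y
    unfolding G_def by (rule sum_le_suminf[OF summable_g]) (auto simp: g_nonneg)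

  \<comment> \<open>In a zero space \<open>shift\<close> with \<open>\<theta> = 1\<close> at the
    origin would read \<open>1 \<le> 0\<close>.\<close>
  obtain x0 :: 'a where x0: "x0 \<noteq> 0"
  proof (rule ccontr)
    assume "\<not> thesis"
    with that have zero: "x = 0" for x :: 'a by blast
    have "0 + 1 *\<^sub>R z 0 0 = 0"
      by (rule blinfun_eqI) (subst zero, simp)
    moreover have "1 - h 0 0 \<le> h 0 (0 + 1 *\<^sub>R z 0 0)" by (rule shift) simp
    moreover have "h 0 0 = 0" using h(1) FVL_subset_Hw Hw_zero by blast
    ultimately show False by simp
  qed
  have "blinfun_apply i x0 \<noteq> 0" using x0 assms(2)[of x0] by auto
  then obtain y0 :: "'b \<Rightarrow>\<^sub>L real" where y0: "blinfun_apply y0 (blinfun_apply i x0) \<noteq> 0"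
    using ex_functional_nonzero by blast
  \<comment> \<open>Scaled so that \<open>delta x\<close> exceeds \<open>G y0\<close> by 1 at the
    restriction of \<open>y0\<close>.\<close>
  define x where "x = ((G y0 + 1) / blinfun_apply y0 (blinfun_apply i x0)) *\<^sub>R x0"
  have dx: "delta x (adj i y) = delta (blinfun_apply i x) y" for y
    by (simp add: delta_def adj_def)
  have "delta x (adj i y0) = G y0 + 1"
    using y0 by (simp add: dx) (simp add: x_def delta_def blinfun.scaleR_right)
  then have pos: "G y0 < \<bar>delta x (adj i y0)\<bar>" by linarith

  \<comment> \<open>Negated because regularity is expressed by suprema: the infimum 0 of the
    positive parts becomes a supremum.\<close>
  define f where "f n \<xi> = - max 0 (\<bar>delta x \<xi>\<bar> - (\<Sum>k<n. 2 ^ k * h k \<xi>))" for n \<xi>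
  have f_FVL: "f n \<in> FVL" for n
    using FVL_minus[OF FVL_max[OF FVL_zero FVL_add[OF FVL_abs[OF delta_in_FVL[of x]]
          FVL_minus[OF FVL_sum[of "\<lambda>k \<xi>. 2 ^ k * h k \<xi>", OF FVL_scale[OF h(1)]]]]], of n]
    by (simp add: f_def[abs_def])
  define w where "w y = - max 0 (\<bar>delta (blinfun_apply i x) y\<bar> - G y)" for y
  have bar_f: "bar i (f n) y = - max 0 (\<bar>delta (blinfun_apply i x) y\<bar> - (\<Sum>k<n. g k y))" for n y
    by (simp add: bar_def f_def g_def dx)
  \<comment> \<open>Taking positive parts does not increase distances, so the approximation errors
    are dominated by the tails of \<open>G\<close>.\<close>
  have w_FBL: "w \<in> FBL p"
  proof (rule FBL_if_limit[OF p])
    show "bar i (f n) \<in> FVL" for n by (rule bar_FVL[OF f_FVL])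
    show "summing_bound p ((1 / 2) ^ n) (\<lambda>y. w y - bar i (f n) y)" for n
    proof (rule summing_bound_mono[OF _ _ order_refl p])
      show "summing_bound p ((1 / 2) ^ n) (\<lambda>y. G y - (\<Sum>k<n. g k y))"
        unfolding G_def by (rule summing_bound_tail(2)[OF p g])
      show "\<bar>w y - bar i (f n) y\<bar> \<le> \<bar>G y - (\<Sum>k<n. g k y)\<bar>" for y
        unfolding bar_f w_def by (auto simp: max_def)
    qed
    show "(\<lambda>n. (1 / 2 :: real) ^ n) \<longlonglongrightarrow> 0" by (rule LIMSEQ_power_zero) simp
  qed

  \<comment> \<open>Over the smaller space every upper bound of the \<open>f n\<close> is
    nonnegative, by \<open>upper_bound_nonneg\<close>.\<close>
  have "isLub (FBL p) (range f) (\<lambda>_. 0)"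
  proof (rule isLubI2)
    show "isUb (FBL p) (range f) (\<lambda>_. 0)"
      using FVL_subset_FBL[OF p] FVL_zero by (auto simp: isUb_def setle_def le_fun_def f_def)
    show "(\<lambda>_. 0) <=* Collect (isUb (FBL p) (range f))"
    proof (rule setgeI, intro ballI le_funI)
      fix v \<xi> assume "v \<in> Collect (isUb (FBL p) (range f))"
      then have v: "v \<in> FBL p" "\<And>n. f n \<le> v" by (auto simp: isUb_def setle_def)
      show "0 \<le> v \<xi>"
      proof (rule upper_bound_nonneg[OF p R, where N = "\<lambda>k. 2 ^ s k" and z = z and b = c and h = h and x = x])
        show "h k \<xi> \<le> (1 / 4) ^ k * (c * norm \<xi>)" for k \<xi>
        proof -
          have "norm (Q (s k) \<xi>) \<le> c * norm \<xi>"
            using norm_blinfun[of "Q (s k)" \<xi>] assms(9)[OF s(1), of k]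
            by (meson mult_right_mono norm_ge_zero order_trans)
          moreover have "real (s k) powr (- 1 / 2) \<le> (1 / 4) ^ k"
            using order_trans[OF s(2)[of k] power_decreasing[of k "Suc k" "1 / 4"]] by simp
          ultimately have "real (s k) powr (- 1 / 2) * norm (Q (s k) \<xi>) \<le> (1 / 4) ^ k * (c * norm \<xi>)"
            by (intro mult_mono) auto
          with h(3)[of k \<xi>] show ?thesis by linarith
        qed
        show "- max 0 (\<bar>delta x \<xi>\<bar> - (\<Sum>k<n. 2 ^ k * h k \<xi>)) \<le> v \<xi>" for n \<xi>
          using v(2)[of n] by (simp add: le_fun_def f_def)
      qed (use h z shift v in auto)
    qed
  qed
  \<comment> \<open>Over the larger space \<open>w\<close> is an upper bound as well, and it is
    negative at \<open>y0\<close>.\<close>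
  moreover have "\<not> isLub (FBL p) (bar i ` range f) (bar i (\<lambda>_. 0))"
  proof
    assume lub: "isLub (FBL p) (bar i ` range f) (bar i (\<lambda>_. 0))"
    have "bar i (f n) y \<le> w y" for n y
      using G_ge[where n = n and y = y] by (auto simp: bar_f w_def)
    then have "isUb (FBL p) (bar i ` range f) w"
      using w_FBL by (auto simp: isUb_def setle_def le_fun_def)
    then have "bar i (\<lambda>_. 0) \<le> w" by (rule isLub_le_isUb[OF lub])
    then have "0 \<le> w y0" by (simp add: le_fun_def bar_def)
    then show False using pos by (simp add: w_def dx)
  qed
  moreover have "range f \<subseteq> FBL p" using f_FVL FVL_subset_FBL[OF p] by blast
  ultimately show ?thesis unfolding regular_image_def by blast
qed

end
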